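(* Let $f:M\to M$ be the edge-to-angle map on the set $M$ of balanced quadrangles. Then: (a) the square is a stationary (fixed) repelling point of $f$; (b) the iterations under $f$ of a balanced quadrangle with edges $(\alpha,\beta,\alpha,\gamma)$ (in cyclic order, i.e. with two equal opposite edges) converge to an attracting 2-cycle of $f$. The angles, in cyclic order, of the two quadrangles of this 2-cycle are $$(1.48342\ldots,\,1.48342\ldots,\,1.65817\ldots,\,1.65817\ldots)\leftrightarrow\left(1.44472\ldots,\,\tfrac{\pi}{2},\,1.44472\ldots,\,\tfrac{\pi}{2}+0.25214\ldots\right).$$
   Context: All quadrangles are convex quadrangles in the plane with perimeter $2\pi$. For a quadrangle $ABCD$ let $x_1,x_2,x_3,x_4$ be the lengths of the edges $DA$, $AB$, $BC$, $CD$, so $x_1+x_2+x_3+x_4=2\pi$; the quadrangle is identified with the point $(x_1,x_2,x_3,x_4)\in\mathbb{R}^4$. For given angles at $A,B,C,D$, the family of all convex quadrangles of perimeter $2\pi$ with these angles corresponds to a finite open segment $I\subset\mathbb{R}^4$. The quadrangle of the family that corresponds to the midpoint of $I$ is called a balanced quadrangle. $M$ denotes the set of balanced quadrangles. The map $f:M\to M$ sends a balanced quadrangle $Q$ to the balanced quadrangle $Q'$ whose angles (in radians, in clockwise order) are numerically equal to the lengths of the edges of $Q$ (also in clockwise order).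
   Formalization: Quadrangles (rhombi) that f sends exactly to the square are exempted from "repelling"; β≠γ is assumed, since otherwise the image is the square; "attracting" is meant among balanced quadrangles with two equal opposite edges or angles, as asymmetric perturbations grow. *)

theory Defs
  imports "HOL-Analysis.Analysis"
begin

text \<open>
  A labelled quadrangle $ABCD$ is a point of \<open>complex^4\<close>; the vertices $A$, $B$, $C$, $D$ are the
  components \<open>1\<close>, \<open>2\<close>, \<open>3\<close>, \<open>4\<close>. Arithmetic in the index type \<open>4\<close> is modulo 4 (so \<open>4 = 0\<close>),
  hence \<open>i + 1\<close> and \<open>i - 1\<close> are the cyclic neighbours of \<open>i\<close>.
\<close>

type_synonym quadrangle = "complex^4"

text \<open>The components of \<open>edges Q\<close> are $x_1 = DA$, $x_2 = AB$, $x_3 = BC$, $x_4 = CD$.\<close>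

definition edges :: "quadrangle \<Rightarrow> real^4" where
  "edges Q = (\<chi> i. dist (Q $ (i - 1)) (Q $ i))"

definition vertex_angle :: "complex \<Rightarrow> complex \<Rightarrow> complex \<Rightarrow> real" where
  "vertex_angle P V R = arccos (((P - V) \<bullet> (R - V)) / (norm (P - V) * norm (R - V)))"

definition angles :: "quadrangle \<Rightarrow> real^4" where
  "angles Q = (\<chi> i. vertex_angle (Q $ (i - 1)) (Q $ i) (Q $ (i + 1)))"

text \<open>
  \<open>Im (cnj z * w) < 0\<close> says that \<open>w\<close> points strictly to the right of \<open>z\<close>. So the vertices are
  listed clockwise, and all vertices off the line of an edge lie strictly to the right of it.
\<close>

definition convex_quadrangle :: "quadrangle \<Rightarrow> bool" where
  "convex_quadrangle Q \<longleftrightarrow>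
     (\<forall>i j. j \<noteq> i \<and> j \<noteq> i + 1 \<longrightarrow>
        Im (cnj (Q $ (i + 1) - Q $ i) * (Q $ j - Q $ i)) < 0)"

definition quadrangle_2pi :: "quadrangle \<Rightarrow> bool" where
  "quadrangle_2pi Q \<longleftrightarrow> convex_quadrangle Q \<and> (\<Sum>i\<in>UNIV. edges Q $ i) = 2 * pi"

definition family :: "real^4 \<Rightarrow> (real^4) set" where
  "family \<theta> = {edges Q | Q. quadrangle_2pi Q \<and> angles Q = \<theta>}"

definition balanced :: "quadrangle \<Rightarrow> bool" where
  "balanced Q \<longleftrightarrow> quadrangle_2pi Q \<and>
     (\<exists>a b. family (angles Q) = open_segment a b \<and> edges Q = midpoint a b)"

text \<open>
  A quadrangle as a geometric figure, up to orientation preserving congruence and up to the choice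
  of the first vertex: the set of the (at most four) pairs of edge and angle lists obtained by
  reading it clockwise.
\<close>

type_synonym figure = "((real^4) \<times> (real^4)) set"

definition figure_of :: "quadrangle \<Rightarrow> figure" where
  "figure_of Q = range (\<lambda>k. ((\<chi> i. edges Q $ (i + k)), (\<chi> i. angles Q $ (i + k))))"

definition balanced_figures :: "figure set" where
  "balanced_figures = figure_of ` {Q. balanced Q}"

definition edge_to_angle :: "figure \<Rightarrow> figure" where
  "edge_to_angle q = (THE q'. \<exists>Q Q'. balanced Q \<and> balanced Q' \<and>
      q = figure_of Q \<and> q' = figure_of Q' \<and> angles Q' = edges Q)"

text \<open>
  Figures are orbits of the isometric action of the cyclic group of order 4 on
  \<open>(real^4) \<times> (real^4)\<close> by shifting both lists, so \<open>setdist\<close> is the quotient metric on them.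

  The edge-to-angle map is not injective: every rhombus is sent to the square. Points that the map
  sends exactly to the fixed point cannot escape and are therefore exempted in the following
  definition. If \<open>p\<close> is its own only preimage, the exemption only concerns \<open>q = p\<close> and the
  definition is the usual one.
\<close>

definition repelling_fixed_point :: "figure \<Rightarrow> bool" where
  "repelling_fixed_point p \<longleftrightarrow> p \<in> balanced_figures \<and> edge_to_angle p = p \<and>
     (\<exists>e>0. \<forall>q\<in>balanced_figures. setdist q p < e \<and> edge_to_angle q \<noteq> p \<longrightarrow>
        (\<exists>n. setdist ((edge_to_angle ^^ n) q) p \<ge> e))"

definition two_cycle :: "figure \<Rightarrow> figure \<Rightarrow> bool" where
  "two_cycle p q \<longleftrightarrow> p \<in> balanced_figures \<and> q \<in> balanced_figures \<and> p \<noteq> q \<and> edge_to_angle p = q \<and> edge_to_angle q = p"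

definition iterates_to :: "nat \<Rightarrow> figure \<Rightarrow> figure \<Rightarrow> bool" where
  "iterates_to k r p \<longleftrightarrow> (\<lambda>n. setdist ((edge_to_angle ^^ (2 * n + k)) r) p) \<longlonglongrightarrow> 0"

definition converges_to_two_cycle :: "figure \<Rightarrow> figure \<Rightarrow> figure \<Rightarrow> bool" where
  "converges_to_two_cycle r p q \<longleftrightarrow>
     (iterates_to 0 r p \<and> iterates_to 1 r q) \<or> (iterates_to 0 r q \<and> iterates_to 1 r p)"

definition attracting_two_cycle_on :: "figure set \<Rightarrow> figure \<Rightarrow> figure \<Rightarrow> bool" where
  "attracting_two_cycle_on S p q \<longleftrightarrow> two_cycle p q \<and> p \<in> S \<and> q \<in> S \<and>
     (\<forall>e>0. \<exists>d>0. \<forall>r\<in>S. min (setdist r p) (setdist r q) < d \<longrightarrow>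
        (\<forall>n. min (setdist ((edge_to_angle ^^ n) r) p) (setdist ((edge_to_angle ^^ n) r) q) < e)) \<and>
     (\<exists>d>0. \<forall>r\<in>S. min (setdist r p) (setdist r q) < d \<longrightarrow> converges_to_two_cycle r p q)"

text \<open>
  The balanced quadrangles with two equal opposite edges, or with two equal opposite angles. The
  edge-to-angle map sends the former to the latter. It sends the latter (kites) to isosceles
  trapezoids, which are among the former. So this is the invariant family in which the
  iterates of the quadrangles with edges \<open>(\<alpha>, \<beta>, \<alpha>, \<gamma>)\<close> live. In all of \<open>balanced_figures\<close> the 2-cycle is not stable:
  asymmetric perturbations of it grow under iteration.
\<close>

definition opposite_equal :: "figure set" where
  "opposite_equal = figure_of ` {Q. balanced Q \<and>
     (\<exists>i. edges Q $ i = edges Q $ (i + 2) \<or> angles Q $ i = angles Q $ (i + 2))}"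

definition square :: quadrangle where
  "square = vector [0, \<i> * of_real (pi / 2), of_real (pi / 2) + \<i> * of_real (pi / 2), of_real (pi / 2)]"

end

theory Submission
  imports Defs
begin

text \<open>
  For given angles, the lengths of the edges are restricted by one complex linear equation and by
  the perimeter. The ends of the resulting segment are (possibly flat) triangles, in which one of two adjacent edges
  has shrunk to 0, and the law of sines makes them and the midpoint explicit
  (\<open>family_normalized\<close>, \<open>balanced_edges_eq\<close>). A rotation of the labels brings every quadrangle into
  the position where this formula holds (\<open>normalized_rot_exists\<close>), so the whole map is explicit.

  Near the square, let \<open>s\<close> and \<open>r\<close> be the deviations from \<open>pi\<close> of two adjacent sums of neighbouring
  angles. To first order the map sends \<open>(s, r)\<close> to \<open>pi / 4\<close> times a vector of length
  \<open>sqrt 2 * norm (s, r)\<close>, so \<open>s\<^sup>2 + r\<^sup>2\<close> grows by a factor close to \<open>pi\<^sup>2 / 8 > 1\<close>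
  (\<open>defect_expands\<close>). The exceptions \<open>s = r = 0\<close> are sent to the square. Hence it is repelling.

  If two opposite edges are equal and the two others are not, the image has two equal opposite angles; reflection in a diagonal
  preserves its family, so the balanced member is a kite. The image of the kite has two pairs of equal
  adjacent angles and is an isosceles trapezoid, which by symmetry has equal legs. From then on the
  figures are isosceles trapezoids and kites by turns, each with a single parameter, and two steps act
  on the parameter of the trapezoid as an increasing map \<open>trap_map\<close> of an interval. The quotient
  \<open>trap_map u / u\<close> is strictly decreasing (\<open>trap_map_slope\<close>), so there is only one positive fixed point,
  and all positive parameters converge to it monotonically (\<open>trap_map_iterates\<close>). This fixed point is
  the 2-cycle; bracketing it gives the decimals (\<open>trap_map_fixed_point\<close>). Monotonicity also gives
  stability, since close to the cycle the figures of the invariant family reach the trapezoids within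
  two steps.
\<close>

section \<open>Relabelling the vertices\<close>

definition rot :: "4 \<Rightarrow> 'a^4 \<Rightarrow> 'a^4" where
  "rot k x = (\<chi> i. x $ (i + k))"

lemma rot_nth [simp]: "rot k x $ i = x $ (i + k)"
  by (simp add: rot_def)

lemma rot_0 [simp]: "rot 0 x = x"
  by (simp add: vec_eq_iff)

lemma rot_rot [simp]: "rot k (rot l x) = rot (k + l) x"
  by (simp add: vec_eq_iff ac_simps)

lemma linear_rot: "linear (rot k :: real^4 \<Rightarrow> real^4)"
  by (rule linearI) (simp_all add: vec_eq_iff)

lemma bij_plus: "bij (\<lambda>i::4. i + k)"
  by (rule bij_betw_byWitness[where f' = "\<lambda>i. i - k"]) auto

lemma inj_rot: "inj (rot k)"
  by (rule inj_on_inverseI[where g = "rot (- k)"]) simp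

lemma sum_rot: "(\<Sum>i\<in>UNIV. rot k x $ i) = (\<Sum>i\<in>UNIV. (x::real^4) $ i)"
  using sum.reindex_bij_betw[OF bij_plus, of "\<lambda>i. x $ i" k] by simp

lemma norm_rot: "norm (rot k x) = norm (x::real^4)"
proof -
  have "rot k x \<bullet> rot k x = x \<bullet> x"
    using sum.reindex_bij_betw[OF bij_plus, of "\<lambda>i. x $ i * x $ i" k]
    by (simp add: inner_vec_def)
  then show ?thesis by (simp add: norm_eq_sqrt_inner)
qed

lemma dist_rot: "dist (rot k x) (rot k y) = dist x (y::real^4)"
proof -
  have "rot k x - rot k y = rot k (x - y)" by (simp add: vec_eq_iff)
  then show ?thesis by (simp add: dist_norm norm_rot)
qed

lemma edges_rot: "edges (rot k Q) = rot k (edges Q)"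
  by (simp add: vec_eq_iff edges_def algebra_simps)

lemma angles_rot: "angles (rot k Q) = rot k (angles Q)"
  by (simp add: vec_eq_iff angles_def algebra_simps)

lemma convex_rot: "convex_quadrangle Q \<Longrightarrow> convex_quadrangle (rot k Q)"
  unfolding convex_quadrangle_def
proof (intro allI impI)
  fix i j :: 4
  assume *: "\<forall>i j. j \<noteq> i \<and> j \<noteq> i + 1 \<longrightarrow> Im (cnj (Q $ (i + 1) - Q $ i) * (Q $ j - Q $ i)) < 0"
    and ij: "j \<noteq> i \<and> j \<noteq> i + 1"
  have c: "i + k + 1 = i + 1 + k" by (simp only: ac_simps)
  have "j + k \<noteq> i + k \<and> j + k \<noteq> i + k + 1" using ij unfolding c by simp
  then show "Im (cnj (rot k Q $ (i + 1) - rot k Q $ i) * (rot k Q $ j - rot k Q $ i)) < 0"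
    using *[rule_format, of "j + k" "i + k"] unfolding c by simp
qed

lemma quadrangle_2pi_rot: "quadrangle_2pi Q \<Longrightarrow> quadrangle_2pi (rot k Q)"
  by (simp add: quadrangle_2pi_def convex_rot edges_rot sum_rot del: rot_nth)

lemma family_rot: "family (rot k \<theta>) = rot k ` family \<theta>"
proof -
  have sub: "rot k ` family \<theta> \<subseteq> family (rot k \<theta>)" for k \<theta>
  proof
    fix y assume "y \<in> rot k ` family \<theta>"
    then obtain Q where "y = edges (rot k Q)" "quadrangle_2pi Q" "angles Q = \<theta>"
      by (auto simp: family_def edges_rot)
    then show "y \<in> family (rot k \<theta>)"
      unfolding family_def using quadrangle_2pi_rot[of Q k] angles_rot[of k Q] by blast
  qed
  have "rot (- k) ` family (rot k \<theta>) \<subseteq> family \<theta>" using sub[of "- k" "rot k \<theta>"] by simp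
  then have "rot k ` rot (- k) ` family (rot k \<theta>) \<subseteq> rot k ` family \<theta>" by (rule image_mono)
  then have "family (rot k \<theta>) \<subseteq> rot k ` family \<theta>" by (simp add: image_image)
  with sub[of k \<theta>] show ?thesis by (intro equalityI)
qed

lemma balanced_rot: assumes "balanced Q" shows "balanced (rot k Q)"
proof -
  from assms obtain a b where ab: "family (angles Q) = open_segment a b" "edges Q = midpoint a b"
    and q: "quadrangle_2pi Q" by (auto simp: balanced_def)
  have "family (angles (rot k Q)) = open_segment (rot k a) (rot k b)"
    by (simp add: angles_rot family_rot ab open_segment_linear_image[OF linear_rot inj_rot])
  moreover have "edges (rot k Q) = midpoint (rot k a) (rot k b)"
    by (simp add: edges_rot ab vec_eq_iff midpoint_def)
  ultimately show ?thesis using quadrangle_2pi_rot[OF q] by (auto simp: balanced_def)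
qed

lemma figure_of_eq: "figure_of Q = range (\<lambda>k. (rot k (edges Q), rot k (angles Q)))"
  by (simp add: figure_of_def rot_def)

lemma figure_of_rot: "figure_of (rot k Q) = figure_of Q"
proof -
  have "figure_of Q = range ((\<lambda>k. (rot k (edges Q), rot k (angles Q))) \<circ> (\<lambda>j. j + k))"
    unfolding figure_of_eq image_comp[symmetric] using bij_plus[of k] by (simp add: bij_is_surj)
  then show ?thesis by (simp add: figure_of_eq edges_rot angles_rot o_def)
qed

lemma figure_of_cong: "edges Q = edges Q' \<Longrightarrow> angles Q = angles Q' \<Longrightarrow> figure_of Q = figure_of Q'"
  by (simp add: figure_of_eq)

lemma figure_of_eqD:
  assumes "figure_of Q = figure_of Q'"
  obtains k where "edges Q' = rot k (edges Q)" "angles Q' = rot k (angles Q)"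
proof -
  have "(edges Q', angles Q') \<in> figure_of Q'" unfolding figure_of_eq by (rule range_eqI[of _ _ 0]) simp
  with assms have "(edges Q', angles Q') \<in> figure_of Q" by simp
  then obtain k where "(edges Q', angles Q') = (rot k (edges Q), rot k (angles Q))"
    unfolding figure_of_eq by (rule rangeE)
  then show ?thesis using that[of k] by simp
qed

section \<open>Quadrangles with prescribed edges and angles\<close>

text \<open>
  The simplifier adds index numerals without reducing them modulo 4.
\<close>

lemma nth_mod_4 [simp]: "x $ (0::4) = x $ 4" "x $ (5::4) = x $ 1" "x $ (6::4) = x $ 2" "x $ (7::4) = x $ 3" "x $ (8::4) = x $ 4"
proof -
  have "(0::4) = 4" "(5::4) = 1" "(6::4) = 2" "(7::4) = 3" "(8::4) = 4" by simp_all
  then show "x $ (0::4) = x $ 4" "x $ (5::4) = x $ 1" "x $ (6::4) = x $ 2" "x $ (7::4) = x $ 3" "x $ (8::4) = x $ 4" by (simp_all only:)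
qed

lemma vector_4 [simp]:
  "(vector [a, b, c, d] :: 'a::zero^4) $ 1 = a"
  "(vector [a, b, c, d] :: 'a::zero^4) $ 2 = b"
  "(vector [a, b, c, d] :: 'a::zero^4) $ 3 = c"
  "(vector [a, b, c, d] :: 'a::zero^4) $ 4 = d"
  by (simp_all add: vector_def)

text \<open>
  The orientation of the triangle on three consecutive vertices decides two of the eight
  convexity conditions, one for each of its two edges on the boundary. So four turns suffice.
\<close>

lemma convex_quadrangle_iff_turns:
  "convex_quadrangle Q \<longleftrightarrow> (\<forall>i. Im (cnj (Q $ i - Q $ (i - 1)) * (Q $ (i + 1) - Q $ i)) < 0)"
proof -
  have T1: "Im (cnj (b - a) * (c - a)) = Im (cnj (b - a) * (c - b))" for a b c :: complex
    by (simp add: algebra_simps)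
  have T2: "Im (cnj (c - b) * (a - b)) = Im (cnj (b - a) * (c - b))" for a b c :: complex
    by (simp add: algebra_simps)
  have cases4: "\<forall>i j::4. j = i \<or> j = i + 1 \<or> j = i + 1 + 1 \<or> j = i - 1"
    by (simp add: forall_4)
  have ne: "\<forall>i::4. i - 1 \<noteq> i \<and> i - 1 \<noteq> i + 1" by (simp add: forall_4)
  show ?thesis
  proof
    assume *: "convex_quadrangle Q"
    show "\<forall>i. Im (cnj (Q $ i - Q $ (i - 1)) * (Q $ (i + 1) - Q $ i)) < 0"
    proof
      fix i :: 4
      have "Im (cnj (Q $ (i + 1) - Q $ i) * (Q $ (i - 1) - Q $ i)) < 0"
        using *[unfolded convex_quadrangle_def, rule_format, of "i - 1" i] ne by simp
      then show "Im (cnj (Q $ i - Q $ (i - 1)) * (Q $ (i + 1) - Q $ i)) < 0"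
        unfolding T2 .
    qed
  next
    assume *: "\<forall>i. Im (cnj (Q $ i - Q $ (i - 1)) * (Q $ (i + 1) - Q $ i)) < 0"
    show "convex_quadrangle Q"
      unfolding convex_quadrangle_def
    proof (intro allI impI)
      fix i j :: 4 assume "j \<noteq> i \<and> j \<noteq> i + 1"
      then consider "j = i + 1 + 1" | "j = i - 1" using cases4 by blast
      then show "Im (cnj (Q $ (i + 1) - Q $ i) * (Q $ j - Q $ i)) < 0"
      proof cases
        case 1
        then show ?thesis using *[rule_format, of "i + 1"]
          by (simp only: 1 T1[where a = "Q $ i" and b = "Q $ (i + 1)"] add_diff_cancel_right')
      next
        case 2
        then show ?thesis using *[rule_format, of i]
          by (simp only: 2 T2[where a = "Q $ (i - 1)" and b = "Q $ i"])
      qed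
    qed
  qed
qed

text \<open>
  The vectors are two consecutive edges \<open>v\<close>, \<open>w\<close>. A clockwise turn puts \<open>- cnj v * w\<close> into the
  upper half plane, where \<open>arccos\<close> recovers the argument. So the angle and the direction of one
  edge determine the direction of the next one.
\<close>

lemma clockwise_turn:
  fixes v w :: complex
  assumes "Im (cnj v * w) < 0"
  defines "\<theta> \<equiv> arccos ((- v) \<bullet> w / (norm v * norm w))"
  shows "0 < \<theta>" "\<theta> < pi" "sgn w = - (sgn v * cis \<theta>)"
proof -
  define z where "z = - cnj v * w"
  have z: "Im z > 0" using assms by (simp add: z_def)
  then have z0: "z \<noteq> 0" by auto
  then have vw: "v \<noteq> 0" "w \<noteq> 0" by (auto simp: z_def)
  have "(- v) \<bullet> w / (norm v * norm w) = Re z / norm z"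
    by (simp add: z_def inner_complex_def norm_mult)
  also have "\<dots> = cos (Arg z)" using z0 by (simp add: cos_Arg)
  finally have \<theta>: "\<theta> = Arg z"
    using Arg_lt_pi[of z] z unfolding \<theta>_def by (simp add: arccos_cos)
  show "0 < \<theta>" "\<theta> < pi" using Arg_lt_pi[of z] z \<theta> by auto
  have "sgn z = cis \<theta>" using z0 \<theta> by (simp add: cis_Arg)
  moreover have "sgn z = - cnj (sgn v) * sgn w" 
    by (simp add: z_def sgn_mult sgn_div_norm sgn_minus scaleR_conv_of_real norm_mult)
  moreover have "sgn v * cnj (sgn v) = 1"
    using vw by (simp add: complex_norm_square[symmetric] norm_sgn)
  ultimately show "sgn w = - (sgn v * cis \<theta>)"
    by (metis (no_types, opaque_lifting) minus_mult_left minus_mult_right minus_minus mult.assoc mult_1)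
qed

lemma clockwise_turn_converse:
  assumes "norm u = 1" "0 < \<theta>" "\<theta> < pi" "0 < x" "0 < y"
    and v: "v = of_real x * u" and w: "w = - (of_real y * (u * cis \<theta>))"
  shows "Im (cnj v * w) < 0" "arccos ((- v) \<bullet> w / (norm v * norm w)) = \<theta>"
proof -
  have u: "cnj u * u = 1" using assms(1) by (metis complex_norm_square mult.commute of_real_1 one_power2)
  have "cnj v * w = - (of_real (x * y) * cis \<theta>) * (cnj u * u)"
    by (simp add: v w)
  then have vw: "cnj v * w = - (of_real (x * y) * cis \<theta>)" by (simp add: u)
  moreover have "0 < x * y * sin \<theta>" using assms by (simp add: sin_gt_zero)
  ultimately show "Im (cnj v * w) < 0" by (simp only:) simp
  have "(- v) \<bullet> w = - Re (cnj v * w)" by (simp add: inner_complex_def)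
  then have "(- v) \<bullet> w = x * y * cos \<theta>" by (simp add: vw del: of_real_mult)
  moreover have "norm v = x" "norm w = y" using assms by (simp_all add: norm_mult)
  ultimately show "arccos ((- v) \<bullet> w / (norm v * norm w)) = \<theta>" using assms by (simp add: arccos_cos)
qed

definition admissible :: "real^4 \<Rightarrow> bool" where
  "admissible \<theta> \<longleftrightarrow> (\<forall>i. 0 < \<theta> $ i \<and> \<theta> $ i < pi) \<and> (\<Sum>i\<in>UNIV. \<theta> $ i) = 2 * pi"

text \<open>
  By the turning rule the directions of the edges are, up to a common rotation,
  \<open>1\<close>, \<open>- cis \<theta>\<^sub>1\<close>, \<open>cis (\<theta>\<^sub>1 + \<theta>\<^sub>2)\<close>, \<open>- cis (\<theta>\<^sub>1 + \<theta>\<^sub>2 + \<theta>\<^sub>3)\<close>, so this says that the polygon with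
  angles \<open>\<theta>\<close> and edge lengths \<open>x\<close> returns to its starting point.
\<close>

definition closes :: "real^4 \<Rightarrow> real^4 \<Rightarrow> bool" where
  "closes \<theta> x \<longleftrightarrow> of_real (x $ 1) - of_real (x $ 2) * cis (\<theta> $ 1)
     + of_real (x $ 3) * cis (\<theta> $ 1 + \<theta> $ 2) - of_real (x $ 4) * cis (\<theta> $ 1 + \<theta> $ 2 + \<theta> $ 3) = 0"

lemma edges_nth: "edges Q $ i = norm (Q $ i - Q $ (i - 1))"
  by (simp add: edges_def dist_norm norm_minus_commute)

lemma angles_nth: "angles Q $ i = arccos ((- (Q $ i - Q $ (i - 1))) \<bullet> (Q $ (i + 1) - Q $ i) /
    (norm (Q $ i - Q $ (i - 1)) * norm (Q $ (i + 1) - Q $ i)))"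
  by (simp add: angles_def vertex_angle_def norm_minus_commute)

text \<open>
  Going around once rotates the direction of an edge by the sum of the angles. So this sum is a
  multiple of \<open>2 * pi\<close>, and it lies strictly between \<open>0\<close> and \<open>4 * pi\<close>.
\<close>

lemma convex_quadrangleD:
  assumes "convex_quadrangle Q"
  shows "admissible (angles Q)" "\<And>i. 0 < edges Q $ i" "closes (angles Q) (edges Q)"
proof -
  let ?v = "\<lambda>i. Q $ i - Q $ (i - 1)" and ?\<theta> = "\<lambda>i. angles Q $ i"
  have turn: "Im (cnj (?v i) * (Q $ (i + 1) - Q $ i)) < 0" for i
    using assms by (simp add: convex_quadrangle_iff_turns)
  note t = clockwise_turn[OF turn, folded angles_nth]
  have v0: "?v i \<noteq> 0" for i using turn[of i] by (cases "?v i = 0") auto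
  then show pos: "0 < edges Q $ i" for i unfolding edges_nth by simp
  have s2: "sgn (?v 2) = - (sgn (?v 1) * cis (?\<theta> 1))" using t(3)[of 1] by simp
  have s3: "sgn (?v 3) = sgn (?v 1) * cis (?\<theta> 1 + ?\<theta> 2)" using t(3)[of 2] s2 by (simp add: cis_mult mult.assoc)
  have s4: "sgn (?v 4) = - (sgn (?v 1) * cis (?\<theta> 1 + ?\<theta> 2 + ?\<theta> 3))" using t(3)[of 3] s3 by (simp add: cis_mult mult.assoc)
  have t4: "sgn (?v 1) = - (sgn (?v 4) * cis (?\<theta> 4))" using t(3)[of 4] by simp
  also have "\<dots> = sgn (?v 1) * cis (?\<theta> 1 + ?\<theta> 2 + ?\<theta> 3 + ?\<theta> 4)"
    unfolding s4 by (simp add: cis_mult mult.assoc)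
  finally have s1: "sgn (?v 1) * cis (?\<theta> 1 + ?\<theta> 2 + ?\<theta> 3 + ?\<theta> 4) = sgn (?v 1)" ..
  have n1: "sgn (?v 1) \<noteq> 0" using v0[of 1] by (simp add: sgn_zero_iff)
  with s1 have "cis (?\<theta> 1 + ?\<theta> 2 + ?\<theta> 3 + ?\<theta> 4) = 1" by (metis mult_cancel_left2)
  then have "cos (?\<theta> 1 + ?\<theta> 2 + ?\<theta> 3 + ?\<theta> 4) = 1" by (simp add: complex_eq_iff)
  then obtain n :: int where n: "?\<theta> 1 + ?\<theta> 2 + ?\<theta> 3 + ?\<theta> 4 = n * 2 * pi"
    by (auto simp: cos_one_2pi_int)
  have lo: "0 < ?\<theta> 1 + ?\<theta> 2 + ?\<theta> 3 + ?\<theta> 4" and hi: "?\<theta> 1 + ?\<theta> 2 + ?\<theta> 3 + ?\<theta> 4 < 4 * pi"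
    using t(1,2)[of 1] t(1,2)[of 2] t(1,2)[of 3] t(1,2)[of 4] by linarith+
  have "0 < real_of_int n" using lo unfolding n by (simp add: zero_less_mult_iff)
  moreover have "real_of_int n * pi < 2 * pi" using hi unfolding n by simp
  then have "real_of_int n < 2" by simp
  ultimately have "n = 1" by linarith
  then have sum: "?\<theta> 1 + ?\<theta> 2 + ?\<theta> 3 + ?\<theta> 4 = 2 * pi" using n by simp
  show "admissible (angles Q)" using t(1,2) sum by (simp add: admissible_def sum_4)
  have vs: "?v i = of_real (edges Q $ i) * sgn (?v i)" for i
    unfolding edges_nth sgn_eq using v0[of i] by (metis nonzero_mult_div_cancel_left norm_eq_zero of_real_eq_0_iff times_divide_eq_right)
  have "?v 1 + ?v 2 + ?v 3 + ?v 4 = 0" by simp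
  then have "of_real (edges Q $ 1) * sgn (?v 1) + of_real (edges Q $ 2) * sgn (?v 2)
     + of_real (edges Q $ 3) * sgn (?v 3) + of_real (edges Q $ 4) * sgn (?v 4) = 0"
    unfolding vs[symmetric] .
  then have "sgn (?v 1) * (of_real (edges Q $ 1) - of_real (edges Q $ 2) * cis (?\<theta> 1)
     + of_real (edges Q $ 3) * cis (?\<theta> 1 + ?\<theta> 2) - of_real (edges Q $ 4) * cis (?\<theta> 1 + ?\<theta> 2 + ?\<theta> 3)) = 0"
    unfolding s2 s3 s4 by (simp add: algebra_simps)
  with n1 show "closes (angles Q) (edges Q)" by (simp add: closes_def)
qed

text \<open>
  Only local data enter: by the turning characterisation of convexity, the polygonal line with
  the prescribed lengths and directions is convex as soon as it closes.
\<close>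

lemma quadrangle_exists:
  assumes \<theta>: "admissible \<theta>" and pos: "\<And>i. 0 < x $ i" and cl: "closes \<theta> x"
  obtains Q where "convex_quadrangle Q" "edges Q = x" "angles Q = \<theta>"
proof -
  define u :: "complex^4" where "u = vector [1, - cis (\<theta> $ 1), cis (\<theta> $ 1 + \<theta> $ 2), - cis (\<theta> $ 1 + \<theta> $ 2 + \<theta> $ 3)]"
  define Q :: quadrangle where "Q = vector [of_real (x $ 1) * u $ 1, of_real (x $ 1) * u $ 1 + of_real (x $ 2) * u $ 2,
     of_real (x $ 1) * u $ 1 + of_real (x $ 2) * u $ 2 + of_real (x $ 3) * u $ 3, 0]"
  have sum: "\<theta> $ 1 + \<theta> $ 2 + \<theta> $ 3 + \<theta> $ 4 = 2 * pi" and r: "0 < \<theta> $ i" "\<theta> $ i < pi" for i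
    using \<theta> by (auto simp: admissible_def sum_4)
  have side: "\<forall>i. Q $ i - Q $ (i - 1) = of_real (x $ i) * u $ i"
    using cl unfolding forall_4 by (simp add: Q_def) (simp add: u_def closes_def algebra_simps)
  have nu: "\<forall>i. norm (u $ i) = 1" unfolding forall_4 by (simp add: u_def)
  have step: "\<forall>i. u $ (i + 1) = - (u $ i * cis (\<theta> $ i))"
    unfolding forall_4 using sum by (simp add: u_def cis_mult)
  have nxt: "Q $ (i + 1) - Q $ i = - (of_real (x $ (i + 1)) * (u $ i * cis (\<theta> $ i)))" for i
    using side[rule_format, of "i + 1"] step by simp
  note t = clockwise_turn_converse[OF nu[rule_format] r pos pos side[rule_format] nxt]
  have "convex_quadrangle Q" using t(1) by (simp add: convex_quadrangle_iff_turns)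
  moreover have "edges Q = x" using side pos nu by (simp add: vec_eq_iff edges_nth norm_mult less_imp_le)
  moreover have "angles Q = \<theta>" using t(2) by (simp add: vec_eq_iff angles_nth)
  ultimately show ?thesis by (rule that)
qed

lemma family_eq:
  assumes "admissible \<theta>"
  shows "family \<theta> = {x. (\<forall>i. 0 < x $ i) \<and> (\<Sum>i\<in>UNIV. x $ i) = 2 * pi \<and> closes \<theta> x}"
proof (intro set_eqI iffI)
  fix x assume "x \<in> family \<theta>"
  then show "x \<in> {x. (\<forall>i. 0 < x $ i) \<and> (\<Sum>i\<in>UNIV. x $ i) = 2 * pi \<and> closes \<theta> x}"
    by (auto simp: family_def quadrangle_2pi_def convex_quadrangleD)
next
  fix x assume x: "x \<in> {x. (\<forall>i. 0 < x $ i) \<and> (\<Sum>i\<in>UNIV. x $ i) = 2 * pi \<and> closes \<theta> x}"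
  then obtain Q where "convex_quadrangle Q" "edges Q = x" "angles Q = \<theta>"
    using quadrangle_exists[OF assms, of x] by auto
  with x show "x \<in> family \<theta>" by (auto simp: family_def quadrangle_2pi_def)
qed

section \<open>The segment of quadrangles with given angles\<close>

text \<open>
  The law of sines: the perimeter of a triangle with two angles \<open>x\<close> and \<open>y\<close> whose circumscribed
  circle has diameter 1.
\<close>

definition tri_perimeter :: "real \<Rightarrow> real \<Rightarrow> real" where
  "tri_perimeter x y = sin x + sin y + sin (x + y)"

text \<open>
  The two degenerate members of the family with angles \<open>\<theta>\<close>, scaled to perimeter 1. When edge 1
  vanishes, a triangle with the angles \<open>\<theta>\<^sub>2\<close> and \<open>\<theta>\<^sub>3\<close> remains; when edge 2 vanishes, one with the angles
  \<open>\<theta>\<^sub>3\<close> and \<open>\<theta>\<^sub>4\<close>. The law of sines gives the other edges.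
\<close>

definition end1 :: "real^4 \<Rightarrow> real^4" where
  "end1 \<theta> = (1 / tri_perimeter (\<theta> $ 2) (\<theta> $ 3)) *\<^sub>R
     vector [0, sin (\<theta> $ 3), sin (\<theta> $ 2 + \<theta> $ 3), sin (\<theta> $ 2)]"

definition end2 :: "real^4 \<Rightarrow> real^4" where
  "end2 \<theta> = (1 / tri_perimeter (\<theta> $ 3) (\<theta> $ 4)) *\<^sub>R
     vector [sin (\<theta> $ 3), 0, sin (\<theta> $ 4), sin (\<theta> $ 3 + \<theta> $ 4)]"

definition balanced_edges :: "real^4 \<Rightarrow> real^4" where
  "balanced_edges \<theta> = pi *\<^sub>R (end1 \<theta> + end2 \<theta>)"

text \<open>
  These inequalities make the two triangles exist, that is, the labelling is such that the edges
  1 and 2 are the ones that can shrink to 0.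
\<close>

definition normalized :: "real^4 \<Rightarrow> bool" where
  "normalized \<theta> \<longleftrightarrow> admissible \<theta> \<and> \<theta> $ 2 + \<theta> $ 3 \<le> pi \<and> \<theta> $ 3 + \<theta> $ 4 \<le> pi"

lemma tri_perimeter_pos:
  assumes "0 < x" "x < pi" "0 < y" "y < pi" "x + y \<le> pi"
  shows "0 < tri_perimeter x y"
proof -
  have "0 < sin x" "0 < sin y" "0 \<le> sin (x + y)"
    using assms by (auto intro: sin_gt_zero sin_ge_zero)
  then show ?thesis by (simp add: tri_perimeter_def)
qed

lemma admissibleD:
  assumes "admissible \<theta>"
  shows "0 < \<theta> $ i" "\<theta> $ i < pi" "\<theta> $ 1 + \<theta> $ 2 + \<theta> $ 3 + \<theta> $ 4 = 2 * pi" "0 < sin (\<theta> $ i)"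
  using assms by (auto simp: admissible_def sum_4 intro: sin_gt_zero)

lemma admissible_rot: "admissible \<theta> \<Longrightarrow> admissible (rot k \<theta>)"
  by (simp add: admissible_def sum_rot del: rot_nth) simp

text \<open>
  Angle sums along opposite edges add up to \<open>2 * pi\<close>, so in each of the two pairs of opposite edges
  one sum is at most \<open>pi\<close>. Two such edges, one from each pair, are adjacent.
\<close>

lemma normalized_rot_exists:
  assumes "admissible \<theta>"
  obtains k where "normalized (rot k \<theta>)"
proof -
  note a = admissibleD(3)[OF assms]
  consider "\<theta> $ 2 + \<theta> $ 3 \<le> pi" "\<theta> $ 3 + \<theta> $ 4 \<le> pi" | "\<theta> $ 3 + \<theta> $ 4 \<le> pi" "\<theta> $ 4 + \<theta> $ 1 \<le> pi"
    | "\<theta> $ 4 + \<theta> $ 1 \<le> pi" "\<theta> $ 1 + \<theta> $ 2 \<le> pi" | "\<theta> $ 1 + \<theta> $ 2 \<le> pi" "\<theta> $ 2 + \<theta> $ 3 \<le> pi"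
    using a by linarith
  then show ?thesis
  proof cases
    case 1 then show ?thesis using that[of 0] assms by (simp add: normalized_def)
  next
    case 2 then show ?thesis using that[of 1] admissible_rot[OF assms, of 1] by (simp add: normalized_def)
  next
    case 3 then show ?thesis using that[of 2] admissible_rot[OF assms, of 2] by (simp add: normalized_def)
  next
    case 4 then show ?thesis using that[of 3] admissible_rot[OF assms, of 3] by (simp add: normalized_def)
  qed
qed

lemma closes_add: "closes \<theta> x \<Longrightarrow> closes \<theta> y \<Longrightarrow> closes \<theta> (x + y)"
  unfolding closes_def by (simp add: algebra_simps)

lemma closes_scaleR:
  assumes "closes \<theta> x" shows "closes \<theta> (c *\<^sub>R x)"
proof -
  have "of_real ((c *\<^sub>R x) $ 1) - of_real ((c *\<^sub>R x) $ 2) * cis (\<theta> $ 1)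
     + of_real ((c *\<^sub>R x) $ 3) * cis (\<theta> $ 1 + \<theta> $ 2) - of_real ((c *\<^sub>R x) $ 4) * cis (\<theta> $ 1 + \<theta> $ 2 + \<theta> $ 3)
   = of_real c * (of_real (x $ 1) - of_real (x $ 2) * cis (\<theta> $ 1)
     + of_real (x $ 3) * cis (\<theta> $ 1 + \<theta> $ 2) - of_real (x $ 4) * cis (\<theta> $ 1 + \<theta> $ 2 + \<theta> $ 3))"
    by (simp add: algebra_simps)
  then show ?thesis using assms by (simp add: closes_def)
qed

lemma closes_unique:
  assumes "admissible \<theta>" "closes \<theta> x" "x $ 1 = 0" "x $ 2 = 0"
  shows "x = 0"
proof -
  have "cis (\<theta> $ 1 + \<theta> $ 2) * (of_real (x $ 3) - of_real (x $ 4) * cis (\<theta> $ 3)) = 0"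
    using assms(2-) by (simp add: closes_def cis_mult[symmetric] algebra_simps)
  then have *: "complex_of_real (x $ 3) - of_real (x $ 4) * cis (\<theta> $ 3) = 0"
    by simp
  then have "x $ 4 * sin (\<theta> $ 3) = 0" by (simp add: complex_eq_iff)
  then have "x $ 4 = 0" using admissibleD(4)[OF assms(1), of 3] by simp
  with * have "x $ 3 = 0" by simp
  with \<open>x $ 4 = 0\<close> assms show ?thesis by (simp add: vec_eq_iff forall_4)
qed

lemma closes_end1: "closes \<theta> (end1 \<theta>)"
proof -
  have *: "- of_real (sin b) + of_real (sin (a + b)) * cis a - of_real (sin a) * cis (a + b) = 0" for a b
    by (simp add: complex_eq_iff sin_add cos_add) (insert sin_cos_squared_add[of a], algebra)
  have "closes \<theta> (vector [0, sin (\<theta> $ 3), sin (\<theta> $ 2 + \<theta> $ 3), sin (\<theta> $ 2)])"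
    using arg_cong[OF *[of "\<theta> $ 3" "\<theta> $ 2"], of "\<lambda>z. cis (\<theta> $ 1) * z"]
    by (simp add: closes_def cis_mult[symmetric] algebra_simps)
  then show ?thesis unfolding end1_def by (rule closes_scaleR)
qed

lemma closes_end2: assumes "admissible \<theta>" shows "closes \<theta> (end2 \<theta>)"
proof -
  have *: "of_real (sin a) + of_real (sin b) * cis (- (a + b)) - of_real (sin (a + b)) * cis (- b) = 0" for a b
    by (simp add: complex_eq_iff sin_diff cos_diff sin_add cos_add) (insert sin_cos_squared_add[of b], algebra)
  have "\<theta> $ 1 + \<theta> $ 2 = 2 * pi + - (\<theta> $ 3 + \<theta> $ 4)" "\<theta> $ 1 + \<theta> $ 2 + \<theta> $ 3 = 2 * pi + - (\<theta> $ 4)"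
    using admissibleD(3)[OF assms] by linarith+
  then have c: "cis (\<theta> $ 1 + \<theta> $ 2) = cis (- (\<theta> $ 3 + \<theta> $ 4))" "cis (\<theta> $ 1 + \<theta> $ 2 + \<theta> $ 3) = cis (- (\<theta> $ 4))"
    by (simp_all only: cis_mult[symmetric] cis_2pi mult_1)
  have "closes \<theta> (vector [sin (\<theta> $ 3), 0, sin (\<theta> $ 4), sin (\<theta> $ 3 + \<theta> $ 4)])"
    using *[of "\<theta> $ 3" "\<theta> $ 4"] unfolding closes_def c by simp
  then show ?thesis unfolding end2_def by (rule closes_scaleR)
qed

lemma ends_distinct:
  assumes "normalized \<theta>" shows "end1 \<theta> \<noteq> end2 \<theta>"
proof -
  have "0 < end2 \<theta> $ 1"
    using assms tri_perimeter_pos[of "\<theta> $ 3" "\<theta> $ 4"] admissibleD[of \<theta>]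
    by (simp add: normalized_def end2_def)
  moreover have "end1 \<theta> $ 1 = 0" by (simp add: end1_def)
  ultimately show ?thesis by auto
qed

text \<open>
  The closing condition leaves a plane of length vectors, spanned by the two ends. Each end is the
  only one that contributes to edge 2 or edge 1, respectively, and all remaining entries are
  nonnegative. So positivity of all edges means positivity of both coefficients.
\<close>

lemma family_normalized:
  assumes "normalized \<theta>"
  shows "family \<theta> = open_segment ((2 * pi) *\<^sub>R end1 \<theta>) ((2 * pi) *\<^sub>R end2 \<theta>)"
proof -
  have adm: "admissible \<theta>" and le: "\<theta> $ 2 + \<theta> $ 3 \<le> pi" "\<theta> $ 3 + \<theta> $ 4 \<le> pi"
    using assms by (auto simp: normalized_def)
  let ?p = "tri_perimeter (\<theta> $ 2) (\<theta> $ 3)" and ?q = "tri_perimeter (\<theta> $ 3) (\<theta> $ 4)"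
  note r = admissibleD(1,2)[OF adm] and s = admissibleD(4)[OF adm]
  have p: "?p > 0" and q: "?q > 0"
    using tri_perimeter_pos r le by auto
  have sn: "0 \<le> sin (\<theta> $ 2 + \<theta> $ 3)" "0 \<le> sin (\<theta> $ 3 + \<theta> $ 4)"
    using r[of 2] r[of 3] r[of 4] le by (auto intro: sin_ge_zero)
  have c: "end1 \<theta> $ 1 = 0" "end1 \<theta> $ 2 > 0" "end1 \<theta> $ 3 \<ge> 0" "end1 \<theta> $ 4 > 0"
     "end2 \<theta> $ 1 > 0" "end2 \<theta> $ 2 = 0" "end2 \<theta> $ 3 > 0" "end2 \<theta> $ 4 \<ge> 0"
    using p q s sn by (simp_all add: end1_def end2_def)
  have sum: "end1 \<theta> $ 1 + end1 \<theta> $ 2 + end1 \<theta> $ 3 + end1 \<theta> $ 4 = 1"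
     "end2 \<theta> $ 1 + end2 \<theta> $ 2 + end2 \<theta> $ 3 + end2 \<theta> $ 4 = 1"
    using p q by (simp_all add: end1_def end2_def add_divide_distrib[symmetric])
      (simp_all add: tri_perimeter_def ac_simps)
  have ne: "(2 * pi) *\<^sub>R end1 \<theta> \<noteq> (2 * pi) *\<^sub>R end2 \<theta>"
    using ends_distinct[OF assms] by simp
  show ?thesis
  proof (intro set_eqI iffI)
    fix x assume "x \<in> family \<theta>"
    then have x: "\<And>i. 0 < x $ i" "x $ 1 + x $ 2 + x $ 3 + x $ 4 = 2 * pi" "closes \<theta> x"
      by (auto simp: family_eq[OF adm] sum_4)
    define l where "l = x $ 2 / end1 \<theta> $ 2"
    define m where "m = x $ 1 / end2 \<theta> $ 1"
    have lm: "0 < l" "0 < m" using x(1) c by (simp_all add: l_def m_def)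
    have "closes \<theta> (x + (- l) *\<^sub>R end1 \<theta> + (- m) *\<^sub>R end2 \<theta>)"
      by (intro closes_add closes_scaleR closes_end1 closes_end2 adm x)
    moreover have "(x + (- l) *\<^sub>R end1 \<theta> + (- m) *\<^sub>R end2 \<theta>) $ 1 = 0" "(x + (- l) *\<^sub>R end1 \<theta> + (- m) *\<^sub>R end2 \<theta>) $ 2 = 0"
      using c by (simp_all add: l_def m_def)
    ultimately have "x + (- l) *\<^sub>R end1 \<theta> + (- m) *\<^sub>R end2 \<theta> = 0" by (rule closes_unique[OF adm])
    then have xe: "x = l *\<^sub>R end1 \<theta> + m *\<^sub>R end2 \<theta>" by (simp add: algebra_simps)
    have "l * (end1 \<theta> $ 1 + end1 \<theta> $ 2 + end1 \<theta> $ 3 + end1 \<theta> $ 4) + m * (end2 \<theta> $ 1 + end2 \<theta> $ 2 + end2 \<theta> $ 3 + end2 \<theta> $ 4) = 2 * pi"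
      using x(2) unfolding xe by (simp add: algebra_simps)
    then have lm2: "l + m = 2 * pi" by (simp add: sum)
    show "x \<in> open_segment ((2 * pi) *\<^sub>R end1 \<theta>) ((2 * pi) *\<^sub>R end2 \<theta>)"
      unfolding in_segment
    proof (intro conjI ne exI[of _ "m / (2 * pi)"])
      have l: "l = 2 * pi - m" using lm2 by simp
      show "0 < m / (2 * pi)" "m / (2 * pi) < 1" using lm lm2 by simp_all
      show "x = (1 - m / (2 * pi)) *\<^sub>R (2 * pi) *\<^sub>R end1 \<theta> + (m / (2 * pi)) *\<^sub>R (2 * pi) *\<^sub>R end2 \<theta>"
        unfolding xe l by (simp add: algebra_simps)
    qed
  next
    fix x assume "x \<in> open_segment ((2 * pi) *\<^sub>R end1 \<theta>) ((2 * pi) *\<^sub>R end2 \<theta>)"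
    then obtain u where u: "0 < u" "u < 1" "x = (1 - u) *\<^sub>R (2 * pi) *\<^sub>R end1 \<theta> + u *\<^sub>R (2 * pi) *\<^sub>R end2 \<theta>"
      unfolding in_segment by blast
    define l where "l = (1 - u) * (2 * pi)"
    define m where "m = u * (2 * pi)"
    have lm: "0 < l" "0 < m" "l + m = 2 * pi" using u by (simp_all add: l_def m_def algebra_simps)
    have xe: "x = l *\<^sub>R end1 \<theta> + m *\<^sub>R end2 \<theta>" by (simp add: u l_def m_def)
    have "l * (end1 \<theta> $ 1 + end1 \<theta> $ 2 + end1 \<theta> $ 3 + end1 \<theta> $ 4) + m * (end2 \<theta> $ 1 + end2 \<theta> $ 2 + end2 \<theta> $ 3 + end2 \<theta> $ 4) = 2 * pi"
      using lm by (simp add: sum)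
    then have "x $ 1 + x $ 2 + x $ 3 + x $ 4 = 2 * pi" unfolding xe by (simp add: algebra_simps)
    moreover have "closes \<theta> x" unfolding xe by (intro closes_add closes_scaleR closes_end1 closes_end2 adm)
    moreover have "\<forall>i. 0 < x $ i" unfolding forall_4 xe using c lm by (simp add: add_nonneg_pos add_pos_nonneg)
    ultimately show "x \<in> family \<theta>" by (simp add: family_eq[OF adm] sum_4)
  qed
qed

lemma midpoint_ends: "midpoint ((2 * pi) *\<^sub>R end1 \<theta>) ((2 * pi) *\<^sub>R end2 \<theta>) = balanced_edges \<theta>"
  by (simp add: midpoint_def balanced_edges_def scaleR_right_distrib)

section \<open>Balanced quadrangles and the edge-to-angle map\<close>

lemma balanced_convex: "balanced Q \<Longrightarrow> convex_quadrangle Q"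
  by (simp add: balanced_def quadrangle_2pi_def)

text \<open>
  A nonempty open segment determines the set of its end points, hence its midpoint.
\<close>

lemma balanced_unique:
  assumes "balanced Q" "balanced Q'" "angles Q = angles Q'"
  shows "edges Q = edges Q'"
proof -
  obtain a b where 1: "family (angles Q) = open_segment a b" "edges Q = midpoint a b"
    using assms(1) unfolding balanced_def by blast
  obtain c d where 2: "family (angles Q') = open_segment c d" "edges Q' = midpoint c d"
    using assms(2) unfolding balanced_def by blast
  have "edges Q \<in> family (angles Q)" using assms(1) by (auto simp: balanced_def family_def)
  then have "a \<noteq> b" using 1 by auto
  moreover have "open_segment a b = open_segment c d" using 1(1) 2(1) assms(3) by metis
  ultimately have "{a, b} = {c, d}" using open_segment_eq by metis
  then show ?thesis unfolding 1 2 by (metis doubleton_eq_iff midpoint_sym)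
qed

lemma normalized_balanced_exists:
  assumes "normalized \<theta>"
  obtains Q where "balanced Q" "angles Q = \<theta>" "edges Q = balanced_edges \<theta>"
proof -
  let ?a = "(2 * pi) *\<^sub>R end1 \<theta>" and ?b = "(2 * pi) *\<^sub>R end2 \<theta>"
  have "balanced_edges \<theta> \<in> family \<theta>"
    unfolding family_normalized[OF assms] midpoint_ends[symmetric]
    using ends_distinct[OF assms] by simp
  then obtain Q where "quadrangle_2pi Q" "angles Q = \<theta>" "edges Q = balanced_edges \<theta>"
    by (auto simp: family_def)
  moreover from this have "balanced Q"
    unfolding balanced_def using family_normalized[OF assms] midpoint_ends[of \<theta>] by metis
  ultimately show ?thesis using that by blast
qed

lemma balanced_edges_eq:
  assumes "balanced Q" "normalized (angles Q)"
  shows "edges Q = balanced_edges (angles Q)"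
  using normalized_balanced_exists[OF assms(2)] balanced_unique[OF assms(1)] by metis

lemma balanced_exists:
  assumes "admissible \<theta>"
  obtains Q where "balanced Q" "angles Q = \<theta>"
proof -
  obtain k where "normalized (rot k \<theta>)" using normalized_rot_exists[OF assms] .
  then obtain Q where "balanced Q" "angles Q = rot k \<theta>" by (rule normalized_balanced_exists)
  then have "balanced (rot (- k) Q)" "angles (rot (- k) Q) = \<theta>"
    by (simp_all add: balanced_rot angles_rot)
  then show ?thesis by (rule that)
qed

text \<open>
  The angles of the image quadrangle must be below \<open>pi\<close>. This is the strict quadrangle inequality,
  read off from the closing condition projected onto the edge in question.
\<close>

lemma admissible_edges:
  assumes "quadrangle_2pi Q" shows "admissible (edges Q)"
proof -
  have one: "edges Q $ 1 < pi" if "quadrangle_2pi Q" for Q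
  proof -
    have Q: "convex_quadrangle Q" and s: "edges Q $ 1 + edges Q $ 2 + edges Q $ 3 + edges Q $ 4 = 2 * pi"
      using that by (auto simp: quadrangle_2pi_def sum_4)
    let ?x = "edges Q" and ?t = "angles Q"
    note pos = convex_quadrangleD(2)[OF Q] and t = admissibleD[OF convex_quadrangleD(1)[OF Q]]
    have "?x $ 1 = ?x $ 2 * cos (?t $ 1) - ?x $ 3 * cos (?t $ 1 + ?t $ 2) + ?x $ 4 * cos (?t $ 1 + ?t $ 2 + ?t $ 3)"
      using convex_quadrangleD(3)[OF Q] by (simp add: closes_def complex_eq_iff)
    moreover have "cos (?t $ 1) < 1" using cos_monotone_0_pi[of 0 "?t $ 1"] t(1,2)[of 1] by simp
    then have "?x $ 2 * cos (?t $ 1) < ?x $ 2" using pos[of 2] by simp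
    moreover have "?x $ 3 * - cos (?t $ 1 + ?t $ 2) \<le> ?x $ 3" 
      using pos[of 3] cos_ge_minus_one[of "?t $ 1 + ?t $ 2"] by (intro mult_left_le) auto
    moreover have "?x $ 4 * cos (?t $ 1 + ?t $ 2 + ?t $ 3) \<le> ?x $ 4" 
      using pos[of 4] by (intro mult_left_le) auto
    ultimately show ?thesis using s by simp
  qed
  have "edges Q $ i < pi" for i using one[OF quadrangle_2pi_rot[OF assms, of "i - 1"]] by (simp add: edges_rot)
  then show ?thesis using assms convex_quadrangleD(2)[of Q] by (auto simp: admissible_def quadrangle_2pi_def)
qed

text \<open>
  The description in the definition of the map is single valued: two labellings of one figure
  differ by a rotation, and the image is rotated in the same way.
\<close>

lemma edge_to_angle_eq:
  assumes "balanced Q" "balanced Q'" "angles Q' = edges Q"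
  shows "edge_to_angle (figure_of Q) = figure_of Q'"
  unfolding edge_to_angle_def
proof (rule the_equality)
  show "\<exists>R R'. balanced R \<and> balanced R' \<and> figure_of Q = figure_of R \<and> figure_of Q' = figure_of R' \<and> angles R' = edges R"
    using assms by blast
next
  fix q' assume "\<exists>R R'. balanced R \<and> balanced R' \<and> figure_of Q = figure_of R \<and> q' = figure_of R' \<and> angles R' = edges R"
  then obtain R R' where R: "balanced R" "balanced R'" "figure_of Q = figure_of R" "q' = figure_of R'" "angles R' = edges R"
    by blast
  obtain k where k: "edges R = rot k (edges Q)" using figure_of_eqD[OF R(3)] .
  have a: "angles (rot k Q') = angles R'" using R k assms by (simp add: angles_rot)
  then have "edges (rot k Q') = edges R'" using balanced_unique R balanced_rot assms(2) by blast
  with a have "figure_of (rot k Q') = figure_of R'" by (intro figure_of_cong)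
  then show "q' = figure_of Q'" using R by (simp add: figure_of_rot)
qed

lemma edge_to_angle_exists:
  assumes "balanced Q"
  obtains Q' where "balanced Q'" "angles Q' = edges Q" "edge_to_angle (figure_of Q) = figure_of Q'"
proof -
  have "admissible (edges Q)" using assms by (simp add: balanced_def admissible_edges)
  then obtain Q' where "balanced Q'" "angles Q' = edges Q" by (rule balanced_exists)
  then show ?thesis using that edge_to_angle_eq[OF assms] by blast
qed

section \<open>Distances between figures\<close>

lemma figure_of_nonempty: "figure_of Q \<noteq> {}"
  by (simp add: figure_of_eq)

lemma setdist_figure_less:
  assumes "setdist (figure_of Q) (figure_of Q') < e"
  obtains k where "dist (edges (rot k Q), angles (rot k Q)) (edges Q', angles Q') < e"
proof -
  obtain x y where xy: "x \<in> figure_of Q" "y \<in> figure_of Q'" "dist x y < e"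
    using setdist_ltE[OF assms figure_of_nonempty figure_of_nonempty] by blast
  then obtain k l where "x = (rot k (edges Q), rot k (angles Q))" "y = (rot l (edges Q'), rot l (angles Q'))"
    unfolding figure_of_eq by blast
  with xy have kl: "dist (rot k (edges Q), rot k (angles Q)) (rot l (edges Q'), rot l (angles Q')) < e"
    by simp
  have "dist (rot (- l) (rot k (edges Q))) (rot (- l) (rot l (edges Q'))) = dist (rot k (edges Q)) (rot l (edges Q'))"
    "dist (rot (- l) (rot k (angles Q))) (rot (- l) (rot l (angles Q'))) = dist (rot k (angles Q)) (rot l (angles Q'))"
    by (rule dist_rot)+
  with kl have "dist (edges (rot (k - l) Q), angles (rot (k - l) Q)) (edges Q', angles Q') < e"
    by (simp add: dist_prod_def edges_rot angles_rot)
  then show ?thesis by (rule that)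
qed

lemma dist_nth_less:
  assumes "dist (x, y) (x', y') < e"
  shows "\<bar>x $ i - x' $ i\<bar> < e" "\<bar>y $ i - y' $ i\<bar> < (e::real)"
proof -
  have "dist x x' < e" "dist y y' < e"
    using assms dist_fst_le[of "(x, y)" "(x', y')"] dist_snd_le[of "(x, y)" "(x', y')"] by auto
  then show "\<bar>x $ i - x' $ i\<bar> < e" "\<bar>y $ i - y' $ i\<bar> < (e::real)"
    using dist_vec_nth_le[of x i x'] dist_vec_nth_le[of y i y'] by (auto simp: dist_real_def)
qed

section \<open>The square is repelling\<close>

lemma angles_square: "angles square = (\<chi> i. pi / 2)"
  unfolding vec_eq_iff forall_4
  by (simp add: angles_def vertex_angle_def square_def inner_complex_def)

lemma edges_square: "edges square = (\<chi> i. pi / 2)"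
  unfolding vec_eq_iff forall_4
  by (simp add: edges_def square_def dist_norm cmod_def)

lemma convex_square: "convex_quadrangle square"
  unfolding convex_quadrangle_iff_turns forall_4
  by (simp add: square_def)

lemma normalized_flat: "normalized (\<chi> i. pi / 2)"
  by (simp add: normalized_def admissible_def)

text \<open>
  If both sums are \<open>pi\<close>, the angles are those of a parallelogram. The segment then joins two
  degenerate parallelograms, and its midpoint is a rhombus.
\<close>

lemma balanced_edges_rhombus:
  assumes "normalized \<theta>" "\<theta> $ 2 + \<theta> $ 3 = pi" "\<theta> $ 3 + \<theta> $ 4 = pi"
  shows "balanced_edges \<theta> = (\<chi> i. pi / 2)"
proof -
  have "\<theta> $ 2 = pi - \<theta> $ 3" "\<theta> $ 4 = pi - \<theta> $ 3" using assms by auto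
  moreover have "sin (\<theta> $ 3) > 0" using assms admissibleD(4) by (auto simp: normalized_def)
  ultimately show ?thesis
    unfolding vec_eq_iff forall_4 by (simp add: balanced_edges_def end1_def end2_def tri_perimeter_def)
qed

lemma balanced_square: "balanced square"
proof -
  obtain Q where Q: "balanced Q" "angles Q = angles square" "edges Q = edges square"
    using normalized_balanced_exists[OF normalized_flat] balanced_edges_rhombus[OF normalized_flat]
    by (auto simp: angles_square edges_square)
  moreover have "quadrangle_2pi square"
    using convex_square by (simp add: quadrangle_2pi_def edges_square sum_4)
  ultimately show ?thesis by (simp add: balanced_def)
qed

text \<open>
  How far the two pairs of opposite edges are from being parallel.
\<close>

definition defect :: "real^4 \<Rightarrow> real" where
  "defect \<theta> = (\<theta> $ 2 + \<theta> $ 3 - pi)\<^sup>2 + (\<theta> $ 3 + \<theta> $ 4 - pi)\<^sup>2"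

text \<open>
  Relabelling by one place swaps the two terms, up to a sign below the square.
\<close>

lemma defect_rot:
  assumes "admissible \<theta>" shows "defect (rot k \<theta>) = defect \<theta>"
proof -
  have sq: "x\<^sup>2 = y\<^sup>2" if "x = - y" for x y :: real using that by simp
  have "\<theta> $ 3 + \<theta> $ 4 - pi = - (\<theta> $ 1 + \<theta> $ 2 - pi)" "\<theta> $ 4 + \<theta> $ 1 - pi = - (\<theta> $ 2 + \<theta> $ 3 - pi)"
    using admissibleD(3)[OF assms] by auto
  note e = sq[OF this(1)] sq[OF this(2)]
  have "\<forall>k. defect (rot k \<theta>) = defect \<theta>"
    unfolding forall_4 defect_def using e by (simp add: add.commute)
  then show ?thesis ..
qed

text \<open>
  The two deviations of the new quadrangle are, up to the factor \<open>pi / 2\<close>, the difference and the sum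
  of the same two quantities, so the mixed terms cancel in the sum of squares. Each quantity is close
  to half of one old deviation, which gives the expansion factor \<open>pi\<^sup>2 / 8 > 1\<close> near the square.
\<close>

lemma defect_balanced_edges_eq:
  assumes "normalized \<theta>"
  defines "a \<equiv> sin (\<theta> $ 2)" and "h \<equiv> sin (\<theta> $ 3)" and "b \<equiv> sin (\<theta> $ 4)"
    and "P \<equiv> tri_perimeter (\<theta> $ 2) (\<theta> $ 3)" and "R \<equiv> tri_perimeter (\<theta> $ 3) (\<theta> $ 4)"
  shows "defect (balanced_edges \<theta>) = pi\<^sup>2 / 2 *
    ((sin (\<theta> $ 2 + \<theta> $ 3) / P + (b - h) / R)\<^sup>2 + (sin (\<theta> $ 3 + \<theta> $ 4) / R + (a - h) / P)\<^sup>2)"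
proof -
  have "admissible \<theta>" using assms by (simp add: normalized_def)
  note r = admissibleD(1,2)[OF this]
  have P: "P > 0" and R: "R > 0"
    using tri_perimeter_pos r assms unfolding normalized_def by auto
  define S where "S = sin (\<theta> $ 2 + \<theta> $ 3)"
  define T where "T = sin (\<theta> $ 3 + \<theta> $ 4)"
  have PS: "P = a + h + S" and RT: "R = h + b + T"
    by (simp_all add: P_def R_def S_def T_def a_def b_def h_def tri_perimeter_def)
  define A where "A = S / P" define B where "B = T / R"
  define d where "d = (b - h) / R" define c where "c = (a - h) / P"
  have ap: "a / P = (1 + c - A) / 2" "h / P = (1 - c - A) / 2"
  proof -
    have "1 + c - A = (P + (a - h) - S) / P" "1 - c - A = (P - (a - h) - S) / P"
      using P by (simp_all add: A_def c_def add_divide_distrib diff_divide_distrib)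
    moreover have "P + (a - h) - S = 2 * a" "P - (a - h) - S = 2 * h" by (simp_all add: PS)
    ultimately show "a / P = (1 + c - A) / 2" "h / P = (1 - c - A) / 2" by simp_all
  qed
  have br: "b / R = (1 + d - B) / 2" "h / R = (1 - d - B) / 2"
  proof -
    have "1 + d - B = (R + (b - h) - T) / R" "1 - d - B = (R - (b - h) - T) / R"
      using R by (simp_all add: B_def d_def add_divide_distrib diff_divide_distrib)
    moreover have "R + (b - h) - T = 2 * b" "R - (b - h) - T = 2 * h" by (simp_all add: RT)
    ultimately show "b / R = (1 + d - B) / 2" "h / R = (1 - d - B) / 2" by simp_all
  qed
  have "defect (balanced_edges \<theta>) = (pi * (h / P + (A + b / R)) - pi)\<^sup>2 + (pi * (A + b / R + (a / P + B)) - pi)\<^sup>2"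
    by (simp add: defect_def balanced_edges_def end1_def end2_def A_def B_def S_def T_def
         a_def[symmetric] b_def[symmetric] h_def[symmetric] P_def[symmetric] R_def[symmetric] algebra_simps)
  also have "\<dots> = pi\<^sup>2 / 2 * ((A + d)\<^sup>2 + (B + c)\<^sup>2)"
    unfolding ap br by (simp add: power2_eq_square field_simps)
  finally show ?thesis by (simp add: A_def B_def c_def d_def S_def T_def)
qed

lemma sin_cubic: "\<bar>sin x - x\<bar> \<le> \<bar>x\<bar> ^ 3 / (6::real)"
  using Maclaurin_sin_bound[of x 3] by (simp add: numeral_eq_Suc sin_coeff_def inverse_eq_divide)

lemma cos_ge_quadratic: "1 - x\<^sup>2 / 2 \<le> cos (x::real)"
proof -
  have "(sin (x / 2))\<^sup>2 \<le> (x / 2)\<^sup>2" using abs_sin_x_le_abs_x[of "x / 2"] by (metis abs_le_square_iff)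
  moreover have "cos x = 1 - 2 * (sin (x / 2))\<^sup>2" using cos_double_sin[of "x / 2"] by simp
  ultimately show ?thesis by (simp add: power2_eq_square)
qed

text \<open>
  The first term of the previous identity is close to \<open>s / 2\<close>; the second is negligible, because
  the sine is nearly constant around \<open>pi / 2\<close>.
\<close>

lemma triangle_term_estimate:
  fixes x y :: real
  assumes "\<bar>x - pi / 2\<bar> \<le> (1/200)" "\<bar>y - pi / 2\<bar> \<le> (1/200)" "x + y \<le> pi"
  defines "P \<equiv> tri_perimeter x y" and "s \<equiv> pi - (x + y)"
  shows "(49/100) * s \<le> sin (x + y) / P" "sin (x + y) / P \<le> (51/100) * s" "\<bar>sin x - sin y\<bar> / P \<le> (1/100) * s"
proof -
  have s: "0 \<le> s" "s \<le> (1/100)" using assms unfolding s_def abs_le_iff by linarith+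
  have S: "sin (x + y) = sin s" by (simp add: s_def)
  have near: "(49999/50000) \<le> sin z" if "\<bar>z - pi / 2\<bar> \<le> (1/200)" for z
  proof -
    have "(z - pi / 2)\<^sup>2 \<le> (1/200)\<^sup>2" using power_mono[OF that abs_ge_zero, of 2] by simp
    then show ?thesis using cos_ge_quadratic[of "z - pi / 2"] by (simp add: cos_diff power2_eq_square)
  qed
  have Sle: "sin s \<le> s" using s by (simp add: sin_x_le_x)
  have "s ^ 3 = s * s\<^sup>2" by (simp add: numeral_eq_Suc)
  also have "\<dots> \<le> s * (1/100)\<^sup>2" using s by (intro mult_left_mono power_mono) auto
  finally have Sge: "(9999/10000) * s \<le> sin s" using sin_cubic[of s] s unfolding abs_le_iff
    by (simp add: power2_eq_square)
  have P: "(19999/10000) \<le> P" "P \<le> (201/100)"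
    using near[OF assms(1)] near[OF assms(2)] Sle Sge s sin_le_one[of x] sin_le_one[of y]
    unfolding P_def tri_perimeter_def S by linarith+
  have "(49/100) * s * P \<le> (49/100) * s * (201/100)" using P s by (intro mult_left_mono) auto
  also have "\<dots> \<le> sin s" using Sge s by simp
  finally show "(49/100) * s \<le> sin (x + y) / P" using P unfolding S by (simp add: pos_le_divide_eq)
  have "sin s \<le> (51/100) * s * (19999/10000)" using Sle s by simp
  also have "\<dots> \<le> (51/100) * s * P" using P s by (intro mult_left_mono) auto
  finally show "sin (x + y) / P \<le> (51/100) * s" using P unfolding S by (simp add: pos_divide_le_eq)
  have "sin x - sin y = 2 * sin ((x - y) / 2) * cos ((x + y) / 2)" by (rule sin_diff_sin)
  also have "cos ((x + y) / 2) = sin (s / 2)" by (simp add: s_def sin_cos_eq field_simps)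
  finally have "\<bar>sin x - sin y\<bar> = 2 * \<bar>sin ((x - y) / 2)\<bar> * \<bar>sin (s / 2)\<bar>" by (simp add: abs_mult)
  also have "\<dots> \<le> 2 * (1/200) * (s / 2)"
  proof (intro mult_mono)
    have "\<bar>(x - y) / 2\<bar> \<le> (1/200)" using assms unfolding abs_le_iff by (simp add: field_simps)
    then show "\<bar>sin ((x - y) / 2)\<bar> \<le> (1/200)" using abs_sin_x_le_abs_x order_trans by blast
    show "\<bar>sin (s / 2)\<bar> \<le> s / 2" using abs_sin_x_le_abs_x[of "s / 2"] s by simp
  qed auto
  also have "\<dots> \<le> (1/100) * s * (19999/10000)" using s by simp
  also have "\<dots> \<le> (1/100) * s * P" using P s by (intro mult_left_mono) auto
  finally show "\<bar>sin x - sin y\<bar> / P \<le> (1/100) * s" using P by (simp add: pos_divide_le_eq)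
qed

lemma defect_expands:
  assumes \<theta>: "normalized \<theta>" and near: "\<And>i. \<bar>\<theta> $ i - pi / 2\<bar> \<le> (1/200)"
  shows "(11/10) * defect \<theta> \<le> defect (balanced_edges \<theta>)"
proof -
  define s where "s = pi - (\<theta> $ 2 + \<theta> $ 3)"
  define r where "r = pi - (\<theta> $ 3 + \<theta> $ 4)"
  have sr: "0 \<le> s" "0 \<le> r" using \<theta> by (auto simp: s_def r_def normalized_def)
  define P where "P = tri_perimeter (\<theta> $ 2) (\<theta> $ 3)"
  define R where "R = tri_perimeter (\<theta> $ 3) (\<theta> $ 4)"
  define A where "A = sin (\<theta> $ 2 + \<theta> $ 3) / P"
  define B where "B = sin (\<theta> $ 3 + \<theta> $ 4) / R"
  define c where "c = (sin (\<theta> $ 2) - sin (\<theta> $ 3)) / P"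
  define d where "d = (sin (\<theta> $ 4) - sin (\<theta> $ 3)) / R"
  have "admissible \<theta>" using assms by (simp add: normalized_def)
  note q = admissibleD(1,2)[OF this]
  have P: "P > 0" and R: "R > 0"
    using tri_perimeter_pos q \<theta> unfolding normalized_def P_def R_def by auto
  have le: "\<theta> $ 2 + \<theta> $ 3 \<le> pi" "\<theta> $ 3 + \<theta> $ 4 \<le> pi" using \<theta> by (auto simp: normalized_def)
  have A: "(49/100) * s \<le> A" "A \<le> (51/100) * s" and c: "\<bar>c\<bar> \<le> (1/100) * s"
    using triangle_term_estimate[OF near near le(1)] P
    by (auto simp: A_def c_def P_def s_def abs_divide)
  have B: "(49/100) * r \<le> B" "B \<le> (51/100) * r" and d: "\<bar>d\<bar> \<le> (1/100) * r"
    using triangle_term_estimate[OF near near le(2)] R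
    by (auto simp: B_def d_def R_def r_def abs_divide abs_minus_commute)
  have key: "((49/100) * x)\<^sup>2 - 2 * ((51/100) * x) * ((1/100) * y) \<le> (X + e)\<^sup>2"
    if "(49/100) * x \<le> X" "X \<le> (51/100) * x" "\<bar>e\<bar> \<le> (1/100) * y" "0 \<le> x" "0 \<le> y" for x y X e :: real
  proof -
    have "((49/100) * x)\<^sup>2 \<le> X\<^sup>2" using that by (intro power_mono) auto
    moreover have "X * \<bar>e\<bar> \<le> 51/100 * x * (1/100 * y)" using that by (intro mult_mono) auto
    moreover have "- (X * e) \<le> X * \<bar>e\<bar>"
      using abs_ge_minus_self[of "X * e"] that by (simp add: abs_mult)
    moreover have "(X + e)\<^sup>2 = X\<^sup>2 + e\<^sup>2 + 2 * (X * e)" by (simp add: power2_sum)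
    ultimately show ?thesis using zero_le_power2[of e] by linarith
  qed
  have "(11/10) * (s\<^sup>2 + r\<^sup>2) \<le> (49/10) * ((229/1000) * (s\<^sup>2 + r\<^sup>2))" by simp
  also have "\<dots> \<le> (49/10) * (((49/100) * s)\<^sup>2 - 2 * ((51/100) * s) * ((1/100) * r) + (((49/100) * r)\<^sup>2 - 2 * ((51/100) * r) * ((1/100) * s)))"
  proof -
    have eq: "(49/100 * s)\<^sup>2 - 2 * (51/100 * s) * (1/100 * r) + ((49/100 * r)\<^sup>2 - 2 * (51/100 * r) * (1/100 * s))
        = 2401/10000 * (s\<^sup>2 + r\<^sup>2) - 102/10000 * (2 * s * r)"
      by (simp add: power2_eq_square algebra_simps)
    have gen: "49/10 * (229/1000 * N) \<le> 49/10 * (2401/10000 * N - 102/10000 * Z)"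
      if "Z \<le> N" "0 \<le> N" for N Z :: real
      using that by (simp add: algebra_simps)
    show ?thesis unfolding eq by (rule gen) (use sum_squares_bound[of s r] in simp_all)
  qed
  also have "\<dots> \<le> 49/10 * ((A + d)\<^sup>2 + (B + c)\<^sup>2)"
    by (intro mult_left_mono add_mono key A B c d sr) auto
  also have "\<dots> \<le> pi\<^sup>2 / 2 * ((A + d)\<^sup>2 + (B + c)\<^sup>2)"
  proof (intro mult_right_mono)
    have "(157/50)\<^sup>2 \<le> pi\<^sup>2" using pi_approx by (intro power_mono) auto
    then show "(49/10) \<le> pi\<^sup>2 / 2" by (simp add: power2_eq_square)
  qed auto
  also have "\<dots> = defect (balanced_edges \<theta>)"
    unfolding defect_balanced_edges_eq[OF \<theta>] A_def B_def c_def d_def P_def R_def ..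
  finally show ?thesis by (simp add: defect_def s_def r_def power2_commute)
qed

lemma near_square:
  assumes "setdist (figure_of Q) (figure_of square) < e"
  shows "\<bar>angles Q $ i - pi / 2\<bar> < e"
proof -
  obtain k where "dist (edges (rot k Q), angles (rot k Q)) (edges square, angles square) < e"
    using setdist_figure_less[OF assms] .
  from dist_nth_less(2)[OF this, of "i - k"] show ?thesis by (simp add: angles_rot angles_square)
qed

lemma defect_grows:
  assumes Q: "balanced Q" and near: "setdist (figure_of Q) (figure_of square) < (1/200)"
  obtains Q' where "balanced Q'" "edge_to_angle (figure_of Q) = figure_of Q'"
    "(11/10) * defect (angles Q) \<le> defect (angles Q')"
proof -
  have adm: "admissible (angles Q)" using Q balanced_convex convex_quadrangleD(1) by blast
  obtain k where k: "normalized (angles (rot k Q))" using normalized_rot_exists[OF adm] by (auto simp: angles_rot)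
  obtain Q' where Q': "balanced Q'" "angles Q' = edges (rot k Q)" "edge_to_angle (figure_of (rot k Q)) = figure_of Q'"
    using edge_to_angle_exists[OF balanced_rot[OF Q]] .
  have "\<bar>angles (rot k Q) $ i - pi / 2\<bar> \<le> (1/200)" for i
    using near_square[OF near, of "i + k"] by (simp add: angles_rot)
  from defect_expands[OF k this] have "(11/10) * defect (angles Q) \<le> defect (angles Q')"
    unfolding Q'(2) balanced_edges_eq[OF balanced_rot[OF Q] k, symmetric]
    by (simp add: angles_rot defect_rot[OF adm])
  then show ?thesis using Q' that by (simp add: figure_of_rot)
qed

text \<open>
  These are the figures that the notion of repelling exempts.
\<close>

lemma defect_eq_0:
  assumes Q: "balanced Q" and "defect (angles Q) = 0"
  shows "edge_to_angle (figure_of Q) = figure_of square"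
proof -
  have adm: "admissible (angles Q)" using Q balanced_convex convex_quadrangleD(1) by blast
  obtain k where k: "normalized (angles (rot k Q))" using normalized_rot_exists[OF adm] by (auto simp: angles_rot)
  have "defect (angles (rot k Q)) = 0" using assms defect_rot[OF adm] by (simp add: angles_rot)
  then have "balanced_edges (angles (rot k Q)) = (\<chi> i. pi / 2)"
    by (intro balanced_edges_rhombus k) (simp_all add: defect_def)
  then have "angles square = edges (rot k Q)"
    using balanced_edges_eq[OF balanced_rot[OF Q] k] by (simp add: angles_square)
  from edge_to_angle_eq[OF balanced_rot[OF Q] balanced_square this] show ?thesis
    by (simp add: figure_of_rot)
qed

lemma defect_le:
  assumes "admissible \<theta>" shows "defect \<theta> \<le> 2 * pi\<^sup>2"
proof -
  note t = admissibleD[OF assms]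
  have "\<bar>\<theta> $ 2 + \<theta> $ 3 - pi\<bar> \<le> \<bar>pi\<bar>" "\<bar>\<theta> $ 3 + \<theta> $ 4 - pi\<bar> \<le> \<bar>pi\<bar>"
    using t(1,2)[of 2] t(1,2)[of 3] t(1,2)[of 4] t(3) unfolding abs_le_iff by auto
  then have "(\<theta> $ 2 + \<theta> $ 3 - pi)\<^sup>2 \<le> pi\<^sup>2" "(\<theta> $ 3 + \<theta> $ 4 - pi)\<^sup>2 \<le> pi\<^sup>2"
    by (simp_all only: abs_le_square_iff)
  then show ?thesis by (simp add: defect_def)
qed

text \<open>
  As long as an orbit stays near the square, its defect grows geometrically. But the defect of any
  quadrangle is bounded.
\<close>

lemma square_repelling: "repelling_fixed_point (figure_of square)"
  unfolding repelling_fixed_point_def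
proof (intro conjI exI[of _ "1/200::real"] ballI impI)
  let ?p = "figure_of square" and ?f = "edge_to_angle"
  show "?p \<in> balanced_figures" using balanced_square by (simp add: balanced_figures_def)
  show "?f ?p = ?p"
    by (intro edge_to_angle_eq balanced_square) (simp add: angles_square edges_square)
  show "(0::real) < (1/200)" by simp
  fix q assume "q \<in> balanced_figures" and q: "setdist q ?p < (1/200) \<and> ?f q \<noteq> ?p"
  then obtain Q where Q: "balanced Q" "q = figure_of Q" by (auto simp: balanced_figures_def)
  have "defect (angles Q) \<noteq> 0" using q defect_eq_0[OF Q(1)] Q(2) by auto
  then have pos: "0 < defect (angles Q)" by (simp add: defect_def less_le)
  show "\<exists>n. (1/200) \<le> setdist ((?f ^^ n) q) ?p"
  proof (rule ccontr)
    assume "\<nexists>n. (1/200) \<le> setdist ((?f ^^ n) q) ?p"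
    then have near: "setdist ((?f ^^ n) q) ?p < (1/200)" for n by (simp add: not_le)
    have "\<exists>Q'. balanced Q' \<and> (?f ^^ n) q = figure_of Q' \<and> (11/10) ^ n * defect (angles Q) \<le> defect (angles Q')" for n
    proof (induction n)
      case 0 then show ?case using Q by auto
    next
      case (Suc n)
      then obtain Q' where Q': "balanced Q'" "(?f ^^ n) q = figure_of Q'" "(11/10) ^ n * defect (angles Q) \<le> defect (angles Q')"
        by blast
      obtain Q'' where "balanced Q''" "?f (figure_of Q') = figure_of Q''" "(11/10) * defect (angles Q') \<le> defect (angles Q'')"
        using defect_grows[OF Q'(1)] near[of n] unfolding Q'(2) by blast
      then show ?case using Q' by (intro exI[of _ Q'']) auto
    qed
    then have bound: "(11/10) ^ n * defect (angles Q) \<le> 2 * pi\<^sup>2" for n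
      by (metis balanced_convex convex_quadrangleD(1) defect_le order_trans)
    obtain n where "2 * pi\<^sup>2 / defect (angles Q) < (11/10) ^ n"
      using real_arch_pow[of "(11/10)" "2 * pi\<^sup>2 / defect (angles Q)"] by auto
    with bound[of n] pos show False by (simp add: pos_divide_less_eq)
  qed
qed

section \<open>The interval map of the trapezoids\<close>

text \<open>
  An isosceles trapezoid with angles \<open>pi / 2 \<plusminus> u\<close> is sent to a kite with angles \<open>pi / 2 - v\<close>,
  \<open>pi / 2\<close>, \<open>pi / 2 - v\<close>, \<open>pi / 2 + 2 * v\<close>, where \<open>v\<close> is \<open>kite_param u\<close>, and this kite to an isosceles
  trapezoid with the parameter \<open>trap_param v\<close>. So \<open>trap_map\<close> is the second iterate of the edge-to-angle
  map on isosceles trapezoids, and \<open>u = 0\<close> is the square.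
\<close>

definition kite_param :: "real \<Rightarrow> real" where
  "kite_param u = pi / 2 * (sin u / (1 + sin u))"

definition trap_param :: "real \<Rightarrow> real" where
  "trap_param v = pi / 2 * ((sin v + cos v - 1) / (sin v + cos v + 1))"

definition trap_map :: "real \<Rightarrow> real" where
  "trap_map u = trap_param (kite_param u)"

text \<open>
  Functions that vanish at 0 and have a decreasing derivative have decreasing \<open>f x / x\<close>: compare the
  mean value of the derivative on \<open>{0..x}\<close> with the one on \<open>{x..y}\<close>.
\<close>

lemma slope_antimono:
  fixes f f' :: "real \<Rightarrow> real"
  assumes "f 0 = 0" "0 < x" "x \<le> y"
    and der: "\<And>t. 0 \<le> t \<Longrightarrow> t \<le> y \<Longrightarrow> (f has_real_derivative f' t) (at t)"
    and anti: "\<And>s t. 0 \<le> s \<Longrightarrow> s \<le> t \<Longrightarrow> t \<le> y \<Longrightarrow> f' t \<le> f' s"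
  shows "x * f y \<le> y * f x"
proof (cases "x = y")
  case False
  then have xy: "x < y" using assms by simp
  obtain s where s: "0 < s" "s < x" "f x - f 0 = (x - 0) * f' s"
    using MVT2[of 0 x f f'] der assms(2,3) by auto
  obtain t where t: "x < t" "t < y" "f y - f x = (y - x) * f' t"
    using MVT2[OF xy, of f f'] der assms(2) by auto
  have "f' t \<le> f' s" using anti[of s t] s t by simp
  then have "x * (y - x) * f' t \<le> x * (y - x) * f' s" using assms xy by (intro mult_left_mono) auto
  moreover have "x * (f y - f x) = x * (y - x) * f' t" "(y - x) * f x = x * (y - x) * f' s"
    using s t assms(1) by simp_all
  ultimately have "x * (f y - f x) \<le> (y - x) * f x" by linarith
  then show ?thesis by (simp add: algebra_simps)
qed simp

lemma sin_slope:
  assumes "0 < x" "x \<le> y" "y \<le> pi"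
  shows "x * sin y \<le> y * sin x"
  by (rule slope_antimono[where f = sin and f' = cos])
    (use assms in \<open>auto intro!: derivative_eq_intros cos_monotone_0_pi_le\<close>)

lemma sin_cos_slope:
  assumes "0 < x" "x \<le> y" "y \<le> pi / 2"
  shows "x * (sin y + cos y - 1) \<le> y * (sin x + cos x - 1)"
proof (rule slope_antimono[where f = "\<lambda>t. sin t + cos t - 1" and f' = "\<lambda>t. cos t - sin t"])
  fix s t :: real assume "0 \<le> s" "s \<le> t" "t \<le> y"
  with assms have "cos t \<le> cos s" "sin s \<le> sin t"
    by (auto intro: cos_monotone_0_pi_le sin_monotone_2pi_le)
  then show "cos t - sin t \<le> cos s - sin s" by simp
qed (use assms in \<open>auto intro!: derivative_eq_intros\<close>)

lemma kite_param_mono: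
  assumes "0 \<le> x" "x \<le> y" "y \<le> pi / 2"
  shows "kite_param x \<le> kite_param y"
proof -
  have "0 \<le> sin x" "sin x \<le> sin y"
    using assms by (auto intro: sin_ge_zero sin_monotone_2pi_le)
  then have "sin x / (1 + sin x) \<le> sin y / (1 + sin y)" by (simp add: field_simps)
  then show ?thesis unfolding kite_param_def by (intro mult_left_mono) auto
qed

lemma kite_param_bounds:
  assumes "0 < u" "u \<le> pi / 2"
  shows "0 < kite_param u" "kite_param u \<le> pi / 4"
proof -
  have s: "0 < sin u" "sin u \<le> 1" using assms by (auto intro: sin_gt_zero)
  then show "0 < kite_param u" by (simp add: kite_param_def)
  have "sin u / (1 + sin u) \<le> 1 / 2" using s by (simp add: field_simps)
  then have "pi / 2 * (sin u / (1 + sin u)) \<le> pi / 2 * (1 / 2)" by (intro mult_left_mono) auto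
  then show "kite_param u \<le> pi / 4" by (simp add: kite_param_def)
qed

lemma kite_param_slope:
  assumes "0 < x" "x < y" "y \<le> pi / 2"
  shows "x * kite_param y < y * kite_param x"
proof -
  have s: "0 < sin x" "0 < sin y" "sin x < sin y"
    using assms by (auto intro: sin_gt_zero sin_monotone_2pi)
  have "x * sin y / (1 + sin y) < x * sin y / (1 + sin x)"
    using s assms by (intro divide_strict_left_mono) auto
  also have "\<dots> \<le> y * sin x / (1 + sin x)"
    using sin_slope[of x y] assms s by (intro divide_right_mono) auto
  finally have "x * sin y / (1 + sin y) < y * sin x / (1 + sin x)" .
  then have "pi / 2 * (x * sin y / (1 + sin y)) < pi / 2 * (y * sin x / (1 + sin x))"
    by (intro mult_strict_left_mono) auto
  moreover have "s * kite_param t = pi / 2 * (s * sin t / (1 + sin t))" for s t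
    by (simp add: kite_param_def)
  ultimately show ?thesis by (simp only:)
qed

lemma sin_plus_cos_mono:
  assumes "0 \<le> x" "x \<le> y" "y \<le> pi / 4"
  shows "sin x + cos x \<le> sin y + cos y"
proof (rule DERIV_nonneg_imp_nondecreasing[OF assms(2), of "\<lambda>t. sin t + cos t"])
  fix t assume "x \<le> t" "t \<le> y"
  with assms have "sin t \<le> sin (pi / 4)" "cos (pi / 4) \<le> cos t"
    by (auto intro: cos_monotone_0_pi_le sin_monotone_2pi_le)
  then have "0 \<le> cos t - sin t" by (simp add: sin_45 cos_45)
  then show "\<exists>d. ((\<lambda>t. sin t + cos t) has_real_derivative d) (at t) \<and> 0 \<le> d"
    by (auto intro!: exI[of _ "cos t - sin t"] derivative_eq_intros)
qed

lemma sin_plus_cos_gt_1: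
  assumes "0 < v" "v < pi / 2" shows "1 < sin v + cos v"
proof -
  have "0 < sin v" "0 < cos v" using assms by (auto intro: sin_gt_zero cos_gt_zero)
  then have "(sin v + cos v)\<^sup>2 > 1" by (simp add: power2_sum)
  then show ?thesis using \<open>0 < sin v\<close> \<open>0 < cos v\<close> using power_less_imp_less_base[of 1 2 "sin v + cos v"] by simp
qed

lemma trap_param_mono:
  assumes "0 \<le> x" "x \<le> y" "y \<le> pi / 4"
  shows "trap_param x \<le> trap_param y"
proof -
  have "0 \<le> sin x + cos x" using assms by (auto intro!: add_nonneg_nonneg sin_ge_zero cos_ge_zero)
  with sin_plus_cos_mono[OF assms]
  have "(sin x + cos x - 1) / (sin x + cos x + 1) \<le> (sin y + cos y - 1) / (sin y + cos y + 1)"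
    by (simp add: field_simps)
  then show ?thesis unfolding trap_param_def by (intro mult_left_mono) auto
qed

lemma trap_param_bounds:
  assumes "0 < v" "v < pi / 2"
  shows "0 < trap_param v" "trap_param v < pi / 2"
proof -
  let ?r = "(sin v + cos v - 1) / (sin v + cos v + 1)"
  have r: "0 < ?r" "?r < 1" using sin_plus_cos_gt_1[OF assms] by (simp_all add: field_simps)
  show "0 < trap_param v" unfolding trap_param_def using r by (intro mult_pos_pos) auto
  show "trap_param v < pi / 2"
    unfolding trap_param_def using mult_strict_left_mono[OF r(2), of "pi / 2"] by simp
qed

lemma trap_param_slope:
  assumes "0 < x" "x \<le> y" "y \<le> pi / 4"
  shows "x * trap_param y \<le> y * trap_param x"
proof -
  define S where "S = (\<lambda>t::real. sin t + cos t)"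
  have S: "1 < S x" "S x \<le> S y" "1 < S y"
    using sin_plus_cos_gt_1[of x] sin_plus_cos_mono[of x y] assms by (auto simp: S_def)
  have "x * (S y - 1) / (S y + 1) \<le> x * (S y - 1) / (S x + 1)"
    using S assms by (intro divide_left_mono) auto
  also have "\<dots> \<le> y * (S x - 1) / (S x + 1)"
    using sin_cos_slope[of x y] assms S by (intro divide_right_mono) (auto simp: S_def)
  finally have "x * (S y - 1) / (S y + 1) \<le> y * (S x - 1) / (S x + 1)" .
  then have "pi / 2 * (x * (S y - 1) / (S y + 1)) \<le> pi / 2 * (y * (S x - 1) / (S x + 1))"
    by (intro mult_left_mono) auto
  moreover have "s * trap_param t = pi / 2 * (s * (S t - 1) / (S t + 1))" for s t
    by (simp add: trap_param_def S_def)
  ultimately show ?thesis by (simp only:)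
qed

lemma trap_map_mono:
  assumes "0 < x" "x \<le> y" "y \<le> pi / 2"
  shows "trap_map x \<le> trap_map y"
  unfolding trap_map_def using assms kite_param_bounds[of x] kite_param_bounds[of y]
  by (intro trap_param_mono kite_param_mono) auto

lemma trap_map_bounds:
  assumes "0 < u" "u \<le> pi / 2"
  shows "0 < trap_map u" "trap_map u < pi / 2"
proof -
  have "0 < kite_param u" "kite_param u < pi / 2" using kite_param_bounds[OF assms] pi_gt_zero by linarith+
  then show "0 < trap_map u" "trap_map u < pi / 2" unfolding trap_map_def by (rule trap_param_bounds)+
qed

text \<open>
  The quotient \<open>trap_map u / u\<close> decreases strictly. It is the product of \<open>trap_param v / v\<close> and \<open>v / u\<close>,
  and each of these is a decreasing slope divided by an increasing positive quantity.
  This makes the positive fixed point unique and attracting from both sides.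
\<close>

lemma trap_map_slope:
  assumes "0 < x" "x < y" "y \<le> pi / 2"
  shows "x * trap_map y < y * trap_map x"
proof -
  let ?k = kite_param
  have k: "0 < ?k x" "0 < ?k y" "?k x \<le> ?k y" "?k y \<le> pi / 4"
    using kite_param_bounds[of x] kite_param_bounds[of y] kite_param_mono[of x y] assms by auto
  have "?k x * (x * trap_map y) = x * (?k x * trap_param (?k y))" by (simp add: trap_map_def)
  also have "\<dots> \<le> x * (?k y * trap_param (?k x))"
    using trap_param_slope[of "?k x" "?k y"] k assms by (intro mult_left_mono) auto
  also have "\<dots> = (x * ?k y) * trap_map x" by (simp add: trap_map_def)
  also have "\<dots> < (y * ?k x) * trap_map x"
    using kite_param_slope[OF assms] trap_map_bounds[of x] assms by (intro mult_strict_right_mono) auto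
  finally have "?k x * (x * trap_map y) < ?k x * (y * trap_map x)" by (simp add: mult_ac)
  then show ?thesis using k by simp
qed

lemma continuous_kite_param:
  assumes "0 < u" "u < pi" shows "isCont kite_param u"
  unfolding kite_param_def using sin_gt_zero[OF assms] by (intro continuous_intros) auto

lemma continuous_trap_param:
  assumes "0 < v" "v < pi / 2" shows "isCont trap_param v"
  unfolding trap_param_def using sin_plus_cos_gt_1[OF assms] by (intro continuous_intros) auto

lemma continuous_trap_map:
  assumes "0 < u" "u \<le> pi / 2" shows "isCont trap_map u"
proof -
  have "isCont (trap_param \<circ> kite_param) u"
  proof (rule continuous_at_compose)
    show "isCont kite_param u" using assms pi_gt_zero by (intro continuous_kite_param) linarith+
    show "isCont trap_param (kite_param u)"
      using kite_param_bounds[OF assms] pi_gt_zero by (intro continuous_trap_param) linarith+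
  qed
  moreover have "trap_param \<circ> kite_param = trap_map" by (simp add: fun_eq_iff trap_map_def)
  ultimately show ?thesis by simp
qed

lemma sin_poly: "0 \<le> x \<Longrightarrow> \<bar>sin x - (x - x ^ 3 / 6 + x ^ 5 / 120)\<bar> \<le> x ^ 7 / (5040::real)"
  using Maclaurin_sin_bound[of x 7]
  by (simp add: numeral_eq_Suc sin_coeff_Suc cos_coeff_Suc inverse_eq_divide)

lemma cos_poly: "0 \<le> x \<Longrightarrow> \<bar>cos x - (1 - x ^ 2 / 2 + x ^ 4 / 24)\<bar> \<le> x ^ 6 / (720::real)"
proof -
  assume "0 \<le> x"
  have sum: "(\<Sum>m<6. cos_coeff m * x ^ m) = 1 - x ^ 2 / 2 + x ^ 4 / 24"
    by (simp add: numeral_eq_Suc sin_coeff_Suc cos_coeff_Suc)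
  have fact: "fact 6 = (720::real)" by (simp add: fact_numeral)
  obtain t where "cos x = (\<Sum>m<6. cos_coeff m * x ^ m) + cos (t + 1 / 2 * real 6 * pi) / fact 6 * x ^ 6"
    using Maclaurin_cos_expansion[of x 6] by blast
  then have "\<bar>cos x - (1 - x ^ 2 / 2 + x ^ 4 / 24)\<bar> = \<bar>cos (t + 1 / 2 * real 6 * pi)\<bar> * x ^ 6 / 720"
    unfolding sum fact using \<open>0 \<le> x\<close> by (simp add: abs_mult)
  also have "\<dots> \<le> 1 * x ^ 6 / 720"
    by (intro divide_right_mono mult_right_mono) auto
  finally show ?thesis by simp
qed

lemma sin_bounds:
  assumes "0 \<le> (x::real)"
  shows "x - x ^ 3 / 6 + x ^ 5 / 120 - x ^ 7 / 5040 \<le> sin x" "sin x \<le> x - x ^ 3 / 6 + x ^ 5 / 120 + x ^ 7 / 5040"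
  using sin_poly[OF assms] unfolding abs_le_iff by linarith+

lemma cos_bounds:
  assumes "0 \<le> (x::real)"
  shows "1 - x ^ 2 / 2 + x ^ 4 / 24 - x ^ 6 / 720 \<le> cos x" "cos x \<le> 1 - x ^ 2 / 2 + x ^ 4 / 24 + x ^ 6 / 720"
  using cos_poly[OF assms] unfolding abs_le_iff by linarith+

text \<open>
  The intermediate value theorem on a bracket of width \<open>2 / 10 ^ 6\<close>. The bracket for \<open>kite_param u\<close>
  separates the two monotone halves of \<open>trap_map\<close>, so that each bound needs a single evaluation of
  sine and cosine, by Taylor polynomials.
\<close>

lemma trap_map_fixed_point:
  obtains u where "0.0873738 \<le> u" "u \<le> 0.0873758" "trap_map u = u"
    "0.1260705 \<le> kite_param u" "kite_param u \<le> 0.1260734"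
proof -
  have pi: "3.141592653 \<le> pi" "pi \<le> 3.141592654" using pi_approx by simp_all
  have quot_ge: "v \<le> c * (a / b)" if "0 < b" "v * b \<le> c * a" for v a b c :: real
    using that by (simp add: pos_le_divide_eq)
  have quot_le: "c * (a / b) \<le> v" if "0 < b" "c * a \<le> v * b" for v a b c :: real
    using that by (simp add: pos_divide_le_eq)
  have kite_ge: "v \<le> kite_param u" if "0 \<le> s" "s \<le> sin u" "v * (1 + s) \<le> 3.141592653 / 2 * s" for u v s
  proof -
    have "s / (1 + s) \<le> sin u / (1 + sin u)" using that by (simp add: field_simps)
    have "v \<le> 3.141592653 / 2 * (s / (1 + s))" using that by (intro quot_ge) auto
    also have "\<dots> \<le> pi / 2 * (sin u / (1 + sin u))"
      using pi that \<open>s / (1 + s) \<le> sin u / (1 + sin u)\<close> by (intro mult_mono) auto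
    finally show ?thesis by (simp add: kite_param_def)
  qed
  have kite_le: "kite_param u \<le> v" if "0 \<le> sin u" "sin u \<le> s" "3.141592654 / 2 * s \<le> v * (1 + s)" for u v s
  proof -
    have "sin u / (1 + sin u) \<le> s / (1 + s)" using that by (simp add: field_simps)
    then have "pi / 2 * (sin u / (1 + sin u)) \<le> 3.141592654 / 2 * (s / (1 + s))"
      using pi that by (intro mult_mono) auto
    also have "\<dots> \<le> v" using that by (intro quot_le) auto
    finally show ?thesis by (simp add: kite_param_def)
  qed
  have trap_ge: "u \<le> trap_param v" if "1 \<le> s" "s \<le> sin v + cos v" "u * (s + 1) \<le> 3.141592653 / 2 * (s - 1)" for u v s
  proof -
    have "(s - 1) / (s + 1) \<le> (sin v + cos v - 1) / (sin v + cos v + 1)" using that by (simp add: field_simps)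
    have "u \<le> 3.141592653 / 2 * ((s - 1) / (s + 1))" using that by (intro quot_ge) auto
    also have "\<dots> \<le> pi / 2 * ((sin v + cos v - 1) / (sin v + cos v + 1))"
      using pi that \<open>(s - 1) / (s + 1) \<le> _\<close> by (intro mult_mono) auto
    finally show ?thesis by (simp add: trap_param_def)
  qed
  have trap_le: "trap_param v \<le> u" if "1 \<le> sin v + cos v" "sin v + cos v \<le> s" "3.141592654 / 2 * (s - 1) \<le> u * (s + 1)" for u v s
  proof -
    have "(sin v + cos v - 1) / (sin v + cos v + 1) \<le> (s - 1) / (s + 1)" using that by (simp add: field_simps)
    then have "pi / 2 * ((sin v + cos v - 1) / (sin v + cos v + 1)) \<le> 3.141592654 / 2 * ((s - 1) / (s + 1))"
      using pi that by (intro mult_mono) auto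
    also have "\<dots> \<le> u" using that by (intro quot_le) auto
    finally show ?thesis by (simp add: trap_param_def)
  qed
  let ?lo = "0.0873738 :: real" and ?hi = "0.0873758 :: real"
  let ?v = "0.1260705 :: real" and ?w = "0.1260734 :: real"
  have k1: "?v \<le> kite_param ?lo"
  proof (rule kite_ge)
    show "0.0872626 \<le> sin ?lo" using sin_bounds[of ?lo] by (simp add: power_divide)
  qed simp_all
  have k2: "kite_param ?hi \<le> ?w"
  proof (rule kite_le)
    show "sin ?hi \<le> 0.0872647" using sin_bounds[of ?hi] by (simp add: power_divide)
    show "0 \<le> sin ?hi" using sin_bounds[of ?hi] by (simp add: power_divide)
  qed simp_all
  have t1: "?lo \<le> trap_param ?v"
  proof (rule trap_ge)
    show "1.1178004 \<le> sin ?v + cos ?v" using sin_bounds[of ?v] cos_bounds[of ?v] by (simp add: power_divide)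
  qed simp_all
  have t2: "trap_param ?w \<le> ?hi"
  proof (rule trap_le)
    show "sin ?w + cos ?w \<le> 1.117803" using sin_bounds[of ?w] cos_bounds[of ?w] by (simp add: power_divide)
    show "1 \<le> sin ?w + cos ?w" using sin_bounds[of ?w] cos_bounds[of ?w] by (simp add: power_divide)
  qed simp_all
  have hp: "?hi \<le> pi / 2" "?w \<le> pi / 4" using pi by simp_all
  have g1: "?lo \<le> trap_map ?lo"
  proof -
    have "trap_param ?v \<le> trap_param (kite_param ?lo)"
      using k1 kite_param_bounds[of ?lo] hp by (intro trap_param_mono) auto
    with t1 show ?thesis by (simp add: trap_map_def)
  qed
  have g2: "trap_map ?hi \<le> ?hi"
  proof -
    have "trap_param (kite_param ?hi) \<le> trap_param ?w"
      using k2 kite_param_bounds[of ?hi] hp by (intro trap_param_mono) auto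
    with t2 show ?thesis by (simp add: trap_map_def)
  qed
  have "\<exists>x\<ge>?lo. x \<le> ?hi \<and> x - trap_map x = 0"
    using g1 g2 hp by (intro IVT') (auto intro!: continuous_intros continuous_at_imp_continuous_on continuous_trap_map)
  then obtain u where u: "?lo \<le> u" "u \<le> ?hi" "trap_map u = u" by auto
  have "?v \<le> kite_param u" using k1 kite_param_mono[of ?lo u] u hp by simp
  moreover have "kite_param u \<le> ?w" using k2 kite_param_mono[of u ?hi] u hp by simp
  ultimately show ?thesis using u that by blast
qed

lemma trap_map_approaches:
  assumes p: "0 < p" "p \<le> pi / 2" "trap_map p = p" and u: "0 < u" "u \<le> pi / 2"
  shows "u \<le> p \<Longrightarrow> u \<le> trap_map u \<and> trap_map u \<le> p"
    and "p \<le> u \<Longrightarrow> p \<le> trap_map u \<and> trap_map u \<le> u"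
proof -
  assume up: "u \<le> p"
  have "u * p \<le> p * trap_map u" using trap_map_slope[of u p] p u up by (cases "u = p") auto
  then have "u \<le> trap_map u" using p by (simp add: mult.commute)
  moreover have "trap_map u \<le> p" using trap_map_mono[of u p] p u up by simp
  ultimately show "u \<le> trap_map u \<and> trap_map u \<le> p" ..
next
  assume up: "p \<le> u"
  have "p * trap_map u \<le> u * p" using trap_map_slope[of p u] p u up by (cases "u = p") auto
  then have "trap_map u \<le> u" using p by (simp add: mult.commute)
  moreover have "p \<le> trap_map u" using trap_map_mono[of p u] p u up by simp
  ultimately show "p \<le> trap_map u \<and> trap_map u \<le> u" by blast
qed

lemma trap_map_fixed_point_unique:
  assumes "0 < p" "p \<le> pi / 2" "trap_map p = p" "0 < q" "q \<le> pi / 2" "trap_map q = q"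
  shows "p = q"
  using trap_map_slope[of p q] trap_map_slope[of q p] assms by (cases p q rule: linorder_cases) auto

text \<open>
  The iterates move monotonically towards the fixed point and cannot overtake it. So they converge,
  and they never leave the initial distance, which is what stability needs.
\<close>

lemma trap_map_iterates:
  assumes p: "0 < p" "p \<le> pi / 2" "trap_map p = p" and u: "0 < u" "u \<le> pi / 2"
  shows "0 < (trap_map ^^ n) u" "(trap_map ^^ n) u \<le> pi / 2" "\<bar>(trap_map ^^ n) u - p\<bar> \<le> \<bar>u - p\<bar>"
    "(\<lambda>n. (trap_map ^^ n) u) \<longlonglongrightarrow> p"
proof -
  let ?x = "\<lambda>n. (trap_map ^^ n) u"
  have r: "0 < ?x n \<and> ?x n \<le> pi / 2" for n
    by (induction n) (use u trap_map_bounds in \<open>auto simp: less_imp_le\<close>)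
  then show "0 < ?x n" "?x n \<le> pi / 2" by auto
  note a = trap_map_approaches[OF p]
  have fixed: "L = p" if "?x \<longlonglongrightarrow> L" "0 < L" "L \<le> pi / 2" for L
  proof -
    have "(\<lambda>n. trap_map (?x n)) \<longlonglongrightarrow> trap_map L"
      using continuous_trap_map[OF that(2,3)] that(1) by (rule isCont_tendsto_compose)
    moreover have "(\<lambda>n. trap_map (?x n)) \<longlonglongrightarrow> L" using LIMSEQ_Suc[OF that(1)] by simp
    ultimately have "trap_map L = L" by (rule LIMSEQ_unique)
    then show ?thesis using trap_map_fixed_point_unique p that by blast
  qed
  have "(\<forall>n. \<bar>?x n - p\<bar> \<le> \<bar>u - p\<bar>) \<and> ?x \<longlonglongrightarrow> p"
  proof (cases "u \<le> p")
    case True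
    have *: "u \<le> ?x n \<and> ?x n \<le> p" for n
    proof (induction n)
      case (Suc n)
      then show ?case using a(1)[of "?x n"] r[of n] by auto
    qed (use True in simp)
    have "incseq ?x" using * a(1) r by (intro incseq_SucI) auto
    then obtain L where L: "?x \<longlonglongrightarrow> L" using * incseq_convergent[of ?x p] by blast
    have "u \<le> L" using * L by (intro LIMSEQ_le_const) auto
    moreover have "L \<le> p" using * L by (intro LIMSEQ_le_const2) auto
    ultimately have "L = p" using L u p by (intro fixed) auto
    moreover have "\<bar>?x n - p\<bar> \<le> \<bar>u - p\<bar>" for n using *[of n] by linarith
    ultimately show ?thesis using L by simp
  next
    case False
    have *: "p \<le> ?x n \<and> ?x n \<le> u" for n
    proof (induction n)
      case (Suc n)
      then show ?case using a(2)[of "?x n"] r[of n] by auto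
    qed (use False in simp)
    have "decseq ?x" using * a(2) r by (intro decseq_SucI) auto
    then obtain L where L: "?x \<longlonglongrightarrow> L" using * decseq_convergent[of ?x p] by blast
    have "L \<le> u" using * L by (intro LIMSEQ_le_const2) auto
    moreover have "p \<le> L" using * L by (intro LIMSEQ_le_const) auto
    ultimately have "L = p" using L u p by (intro fixed) auto
    moreover have "\<bar>?x n - p\<bar> \<le> \<bar>u - p\<bar>" for n using *[of n] by linarith
    ultimately show ?thesis using L by simp
  qed
  then show "\<bar>?x n - p\<bar> \<le> \<bar>u - p\<bar>" "?x \<longlonglongrightarrow> p" by auto
qed

section \<open>Trapezoids and kites\<close>

definition figure :: "real^4 \<Rightarrow> real^4 \<Rightarrow> figure" where
  "figure x \<theta> = range (\<lambda>k. (rot k x, rot k \<theta>))"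

text \<open>
  For \<open>0 \<le> u\<close> and \<open>\<alpha> + \<gamma> \<le> pi\<close> these labellings are normalized. Kites are
  parametrised by their two equal angles \<open>\<alpha>\<close> and by the smaller one \<open>\<gamma>\<close> of the two others; the kites of the cycle are those with \<open>\<gamma> = pi / 2\<close>.
\<close>

definition trap_angles :: "real \<Rightarrow> real^4" where
  "trap_angles u = vector [pi / 2 + u, pi / 2 + u, pi / 2 - u, pi / 2 - u]"

definition kite_angles :: "real \<Rightarrow> real \<Rightarrow> real^4" where
  "kite_angles \<alpha> \<gamma> = vector [2 * pi - 2 * \<alpha> - \<gamma>, \<alpha>, \<gamma>, \<alpha>]"

text \<open>
  The first two edges of the balanced kite are \<open>pi / 2 - kite_to_trap \<alpha> \<gamma>\<close>, the last two are
  \<open>pi / 2 + kite_to_trap \<alpha> \<gamma>\<close>.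
\<close>

definition kite_to_trap :: "real \<Rightarrow> real \<Rightarrow> real" where
  "kite_to_trap \<alpha> \<gamma> = pi / 2 - pi * sin \<gamma> / tri_perimeter \<alpha> \<gamma>"

abbreviation special_kite_angles :: "real \<Rightarrow> real^4" where
  "special_kite_angles v \<equiv> kite_angles (pi / 2 - v) (pi / 2)"

definition trap_figure :: "real \<Rightarrow> figure" where
  "trap_figure u = figure (rot 1 (special_kite_angles (kite_param u))) (trap_angles u)"

definition kite_figure :: "real \<Rightarrow> real \<Rightarrow> figure" where
  "kite_figure \<alpha> \<gamma> = figure (rot 2 (trap_angles (kite_to_trap \<alpha> \<gamma>))) (kite_angles \<alpha> \<gamma>)"

lemma figure_of_figure: "figure_of Q = figure (edges Q) (angles Q)"
  by (simp add: figure_of_eq figure_def)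

lemma trap_admissible: "\<bar>u\<bar> < pi / 2 \<Longrightarrow> admissible (trap_angles u)"
  by (auto simp: admissible_def trap_angles_def forall_4 sum_4)

lemma trap_normalized: "0 \<le> u \<Longrightarrow> u < pi / 2 \<Longrightarrow> normalized (trap_angles u)"
  using trap_admissible[of u] by (simp add: normalized_def) (simp add: trap_angles_def)

lemma kite_normalized:
  "admissible (kite_angles \<alpha> \<gamma>) \<Longrightarrow> \<alpha> + \<gamma> \<le> pi \<Longrightarrow> normalized (kite_angles \<alpha> \<gamma>)"
  by (simp add: normalized_def) (simp add: kite_angles_def add.commute)

lemma kite_admissible:
  "0 < \<alpha> \<Longrightarrow> \<alpha> < pi \<Longrightarrow> 0 < \<gamma> \<Longrightarrow> \<gamma> < pi \<Longrightarrow> pi < 2 * \<alpha> + \<gamma> \<Longrightarrow> 2 * \<alpha> + \<gamma> < 2 * pi \<Longrightarrow> admissible (kite_angles \<alpha> \<gamma>)"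
  by (auto simp: admissible_def kite_angles_def forall_4 sum_4)

lemma kite_admissibleD:
  assumes "admissible (kite_angles \<alpha> \<gamma>)"
  shows "0 < \<alpha>" "\<alpha> < pi" "0 < \<gamma>" "\<gamma> < pi"
  using admissibleD(1,2)[OF assms, of 2] admissibleD(1,2)[OF assms, of 3] by (auto simp: kite_angles_def)

lemma balanced_edges_trap:
  assumes "0 \<le> u" "u < pi / 2"
  shows "balanced_edges (trap_angles u) = rot 1 (special_kite_angles (kite_param u))"
proof -
  have c: "0 < cos u" and s: "0 \<le> sin u" using assms by (auto intro: cos_gt_zero_pi sin_ge_zero)
  have sines: "sin (pi / 2 + u) = cos u" "sin (pi / 2 - u) = cos u"
    by (simp_all add: sin_add sin_diff)
  have sin_sum_1: "sin (pi / 2 + u + (pi / 2 - u)) = 0" by simp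
  have "pi / 2 - u + (pi / 2 - u) = pi - 2 * u" by simp
  then have sin_sum_2: "sin (pi / 2 - u + (pi / 2 - u)) = 2 * sin u * cos u"
    by (simp only: sin_pi_minus sin_double)
  have P: "tri_perimeter (pi / 2 + u) (pi / 2 - u) = 2 * cos u"
    unfolding tri_perimeter_def sin_sum_1 sines by simp
  have R: "tri_perimeter (pi / 2 - u) (pi / 2 - u) = 2 * cos u * (1 + sin u)"
    unfolding tri_perimeter_def sin_sum_2 sines by (simp add: algebra_simps)
  have e1: "end1 (trap_angles u) = vector [0, 1 / 2, 0, 1 / 2]"
    using c unfolding vec_eq_iff forall_4 end1_def trap_angles_def vector_4 P sin_sum_1 sines
    by simp
  have e2: "end2 (trap_angles u) = vector [1 / (2 * (1 + sin u)), 0, 1 / (2 * (1 + sin u)), sin u / (1 + sin u)]"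
    using c s unfolding vec_eq_iff forall_4 end2_def trap_angles_def vector_4 R sin_sum_2 sines
    by simp
  show ?thesis
    using s unfolding vec_eq_iff forall_4
    by (simp add: balanced_edges_def e1 e2 kite_angles_def kite_param_def field_simps)
qed

lemma balanced_edges_kite:
  assumes "admissible (kite_angles \<alpha> \<gamma>)" "\<alpha> + \<gamma> \<le> pi"
  shows "balanced_edges (kite_angles \<alpha> \<gamma>) = rot 2 (trap_angles (kite_to_trap \<alpha> \<gamma>))"
proof -
  have P: "0 < tri_perimeter \<alpha> \<gamma>" using kite_admissibleD[OF assms(1)] assms(2) by (intro tri_perimeter_pos)
  have sym: "tri_perimeter \<gamma> \<alpha> = tri_perimeter \<alpha> \<gamma>" by (simp add: tri_perimeter_def add.commute)
  have "sin \<alpha> / tri_perimeter \<alpha> \<gamma> + sin (\<alpha> + \<gamma>) / tri_perimeter \<alpha> \<gamma> + sin \<gamma> / tri_perimeter \<alpha> \<gamma> = 1"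
    using P by (simp add: add_divide_distrib[symmetric]) (simp add: tri_perimeter_def)
  then have "pi * (sin (\<alpha> + \<gamma>) / tri_perimeter \<alpha> \<gamma> + sin \<alpha> / tri_perimeter \<alpha> \<gamma>) = pi * (1 - sin \<gamma> / tri_perimeter \<alpha> \<gamma>)"
    by (intro arg_cong[where f = "\<lambda>x. pi * x"]) linarith
  then show ?thesis
    unfolding vec_eq_iff forall_4
    by (simp add: balanced_edges_def end1_def end2_def kite_angles_def trap_angles_def kite_to_trap_def sym
        add.commute[of \<gamma> \<alpha>] algebra_simps)
qed

lemma trap_edges:
  assumes "balanced Q" "angles Q = trap_angles u" "0 \<le> u" "u < pi / 2"
  shows "edges Q = rot 1 (special_kite_angles (kite_param u))" "figure_of Q = trap_figure u"
  using balanced_edges_eq[OF assms(1)] trap_normalized[OF assms(3,4)] assms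
  by (simp_all add: balanced_edges_trap figure_of_figure trap_figure_def)

lemma kite_edges:
  assumes "balanced Q" "angles Q = kite_angles \<alpha> \<gamma>" "\<alpha> + \<gamma> \<le> pi"
  shows "edges Q = rot 2 (trap_angles (kite_to_trap \<alpha> \<gamma>))" "figure_of Q = kite_figure \<alpha> \<gamma>"
proof -
  have adm: "admissible (kite_angles \<alpha> \<gamma>)"
    using assms balanced_convex convex_quadrangleD(1) by metis
  show "edges Q = rot 2 (trap_angles (kite_to_trap \<alpha> \<gamma>))"
    using balanced_edges_eq[OF assms(1)] kite_normalized[OF adm] balanced_edges_kite[OF adm] assms by simp
  then show "figure_of Q = kite_figure \<alpha> \<gamma>"
    by (simp add: figure_of_figure kite_figure_def assms)
qed

lemma edge_to_angle_rot:
  assumes "balanced Q" "edges Q = rot k \<theta>"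
  obtains Q' where "balanced Q'" "angles Q' = \<theta>" "edge_to_angle (figure_of Q) = figure_of Q'"
proof -
  obtain Q' where Q': "balanced Q'" "angles Q' = edges (rot (- k) Q)" "edge_to_angle (figure_of (rot (- k) Q)) = figure_of Q'"
    using edge_to_angle_exists[OF balanced_rot[OF assms(1)]] .
  show ?thesis
    using Q' assms(2) by (intro that[of Q']) (simp_all add: edges_rot figure_of_rot)
qed

lemma kite_param_less:
  assumes "0 < u" "u < pi / 2" shows "kite_param u < pi / 4"
proof -
  have s: "0 < sin u" "sin u < 1"
    using assms sin_monotone_2pi[of u "pi / 2"] by (auto intro: sin_gt_zero)
  then have "sin u / (1 + sin u) < 1 / 2" by (simp add: field_simps)
  from mult_strict_left_mono[OF this, of "pi / 2"] show ?thesis by (simp add: kite_param_def)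
qed

lemma kite_to_trap_special: 
  assumes "0 < v" "v < pi / 2" shows "kite_to_trap (pi / 2 - v) (pi / 2) = trap_param v"
proof -
  have "pi / 2 - v + pi / 2 = pi - v" by simp
  then have "sin (pi / 2 - v + pi / 2) = sin v" by (simp only: sin_pi_minus)
  then have P: "tri_perimeter (pi / 2 - v) (pi / 2) = sin v + cos v + 1"
    by (simp add: tri_perimeter_def sin_diff)
  show ?thesis
    using sin_plus_cos_gt_1[OF assms] unfolding kite_to_trap_def trap_param_def P
    by (simp add: field_simps)
qed

text \<open>
  The lower bound is the triangle inequality for the triangle with angles \<open>\<alpha>\<close> and \<open>\<gamma>\<close>.
\<close>

lemma kite_to_trap_bounds:
  assumes "admissible (kite_angles \<alpha> \<gamma>)" "\<alpha> + \<gamma> < pi"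
  shows "0 < kite_to_trap \<alpha> \<gamma>" "kite_to_trap \<alpha> \<gamma> < pi / 2"
proof -
  note r = kite_admissibleD[OF assms(1)]
  have s: "0 < sin \<alpha>" "0 < sin \<gamma>" "0 < sin (\<alpha> + \<gamma>)" using r assms(2) by (auto intro: sin_gt_zero)
  then have P: "0 < tri_perimeter \<alpha> \<gamma>" by (simp add: tri_perimeter_def)
  have "cos \<alpha> < 1" using cos_monotone_0_pi[of 0 \<alpha>] r by simp
  have "sin \<gamma> = sin (\<alpha> + \<gamma>) * cos \<alpha> + sin \<alpha> * - cos (\<alpha> + \<gamma>)"
    using sin_diff[of "\<alpha> + \<gamma>" \<alpha>] by simp
  also have "\<dots> < sin (\<alpha> + \<gamma>) * 1 + sin \<alpha> * 1"
    using s \<open>cos \<alpha> < 1\<close> cos_ge_minus_one[of "\<alpha> + \<gamma>"]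
    by (intro add_less_le_mono mult_strict_left_mono mult_left_mono) auto
  finally have "sin \<gamma> / tri_perimeter \<alpha> \<gamma> < 1 / 2" using P by (simp add: tri_perimeter_def field_simps)
  from mult_strict_left_mono[OF this, of pi] show "0 < kite_to_trap \<alpha> \<gamma>" by (simp add: kite_to_trap_def)
  show "kite_to_trap \<alpha> \<gamma> < pi / 2" using s P by (simp add: kite_to_trap_def)
qed

lemma trap_step:
  assumes "0 < u" "u < pi / 2"
  shows "edge_to_angle (trap_figure u) = kite_figure (pi / 2 - kite_param u) (pi / 2)"
proof -
  obtain Q where Q: "balanced Q" "angles Q = trap_angles u"
    using balanced_exists trap_admissible assms by (metis abs_of_pos)
  note e = trap_edges[OF Q less_imp_le[OF assms(1)] assms(2)]
  obtain Q' where Q': "balanced Q'" "angles Q' = special_kite_angles (kite_param u)"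
      "edge_to_angle (figure_of Q) = figure_of Q'"
    using edge_to_angle_rot[OF Q(1) e(1)] .
  have "pi / 2 - kite_param u + pi / 2 \<le> pi" using kite_param_bounds(1)[of u] assms by simp
  from kite_edges(2)[OF Q'(1,2) this] Q'(3) e(2) show ?thesis by simp
qed

lemma kite_step_of:
  assumes "balanced Q" "angles Q = kite_angles \<alpha> \<gamma>" "\<alpha> + \<gamma> < pi"
  shows "edge_to_angle (figure_of Q) = trap_figure (kite_to_trap \<alpha> \<gamma>)"
    "0 < kite_to_trap \<alpha> \<gamma>" "kite_to_trap \<alpha> \<gamma> < pi / 2"
proof -
  have adm: "admissible (kite_angles \<alpha> \<gamma>)"
    using assms balanced_convex convex_quadrangleD(1) by metis
  show b: "0 < kite_to_trap \<alpha> \<gamma>" "kite_to_trap \<alpha> \<gamma> < pi / 2" using kite_to_trap_bounds[OF adm assms(3)] by auto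
  obtain Q' where Q': "balanced Q'" "angles Q' = trap_angles (kite_to_trap \<alpha> \<gamma>)"
      "edge_to_angle (figure_of Q) = figure_of Q'"
    using edge_to_angle_rot[OF assms(1) kite_edges(1)[OF assms(1,2)]] assms(3) by (metis less_imp_le)
  then show "edge_to_angle (figure_of Q) = trap_figure (kite_to_trap \<alpha> \<gamma>)"
    using trap_edges(2)[OF Q'(1,2)] b by simp
qed

lemma kite_step:
  assumes "0 < v" "v < pi / 4"
  shows "edge_to_angle (kite_figure (pi / 2 - v) (pi / 2)) = trap_figure (trap_param v)"
proof -
  have adm: "admissible (special_kite_angles v)" using assms by (intro kite_admissible) auto
  then obtain Q where Q: "balanced Q" "angles Q = special_kite_angles v" by (rule balanced_exists)
  have "edge_to_angle (figure_of Q) = trap_figure (kite_to_trap (pi / 2 - v) (pi / 2))"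
    using Q assms by (intro kite_step_of(1)) auto
  moreover have "figure_of Q = kite_figure (pi / 2 - v) (pi / 2)" using Q assms by (intro kite_edges(2)) auto
  ultimately show ?thesis using kite_to_trap_special[of v] assms by simp
qed

lemma trap_orbit:
  assumes "0 < u" "u < pi / 2"
  shows "(edge_to_angle ^^ (2 * n)) (trap_figure u) = trap_figure ((trap_map ^^ n) u)"
    "(edge_to_angle ^^ (2 * n + 1)) (trap_figure u) = kite_figure (pi / 2 - kite_param ((trap_map ^^ n) u)) (pi / 2)"
proof -
  let ?x = "\<lambda>n. (trap_map ^^ n) u"
  have r: "0 < ?x n \<and> ?x n < pi / 2" for n
    by (induction n) (use assms trap_map_bounds in \<open>auto simp: less_imp_le\<close>)
  have even: "(edge_to_angle ^^ (2 * n)) (trap_figure u) = trap_figure (?x n)" for n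
  proof (induction n)
    case (Suc n)
    have "(edge_to_angle ^^ (2 * Suc n)) (trap_figure u) = edge_to_angle (edge_to_angle (trap_figure (?x n)))"
      using Suc by simp
    also have "\<dots> = trap_figure (trap_map (?x n))"
      using r[of n] kite_param_bounds(1)[of "?x n"] kite_param_less[of "?x n"]
      by (simp add: trap_step kite_step trap_map_def)
    finally show ?case by simp
  qed simp
  then show "(edge_to_angle ^^ (2 * n)) (trap_figure u) = trap_figure (?x n)" .
  show "(edge_to_angle ^^ (2 * n + 1)) (trap_figure u) = kite_figure (pi / 2 - kite_param (?x n)) (pi / 2)"
    using even[of n] trap_step r[of n] by simp
qed

lemma setdist_figure_l1:
  "setdist (figure x \<theta>) (figure x' \<theta>') \<le> (\<Sum>i\<in>UNIV. \<bar>x $ i - x' $ i\<bar>) + (\<Sum>i\<in>UNIV. \<bar>\<theta> $ i - \<theta>' $ i\<bar>)"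
proof -
  have m: "(x, \<theta>) \<in> figure x \<theta>" for x \<theta>
    unfolding figure_def by (rule range_eqI[of _ _ 0]) simp
  have "setdist (figure x \<theta>) (figure x' \<theta>') \<le> dist (x, \<theta>) (x', \<theta>')"
    by (intro setdist_le_dist m)
  also have "\<dots> \<le> dist x x' + dist \<theta> \<theta>'"
    by (simp add: dist_prod_def sqrt_sum_squares_le_sum)
  also have "\<dots> \<le> (\<Sum>i\<in>UNIV. \<bar>x $ i - x' $ i\<bar>) + (\<Sum>i\<in>UNIV. \<bar>\<theta> $ i - \<theta>' $ i\<bar>)"
    using norm_le_l1_cart[of "x - x'"] norm_le_l1_cart[of "\<theta> - \<theta>'"] by (simp add: dist_norm)
  finally show ?thesis .
qed

lemma setdist_trap:
  "setdist (trap_figure u) (trap_figure u') \<le> 4 * \<bar>kite_param u - kite_param u'\<bar> + 4 * \<bar>u - u'\<bar>"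
proof -
  have "\<bar>2 * kite_param u - 2 * kite_param u'\<bar> = 2 * \<bar>kite_param u - kite_param u'\<bar>" by (simp add: abs_if)
  then show ?thesis
    unfolding trap_figure_def
    by (intro order_trans[OF setdist_figure_l1])
      (simp add: sum_4 kite_angles_def trap_angles_def abs_minus_commute)
qed

lemma setdist_kite:
  "setdist (kite_figure \<alpha> \<gamma>) (kite_figure \<alpha>' \<gamma>') \<le>
    4 * \<bar>kite_to_trap \<alpha> \<gamma> - kite_to_trap \<alpha>' \<gamma>'\<bar> + 4 * \<bar>\<alpha> - \<alpha>'\<bar> + 2 * \<bar>\<gamma> - \<gamma>'\<bar>"
proof -
  have "\<bar>2 * \<alpha>' + \<gamma>' - \<gamma> - 2 * \<alpha>\<bar> \<le> 2 * \<bar>\<alpha> - \<alpha>'\<bar> + \<bar>\<gamma> - \<gamma>'\<bar>" by (auto simp: abs_if)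
  then show ?thesis
    unfolding kite_figure_def
    by (intro order_trans[OF setdist_figure_l1])
      (simp add: sum_4 kite_angles_def trap_angles_def abs_minus_commute)
qed

section \<open>The 2-cycle\<close>

lemma iterates_to_edge_to_angle: "iterates_to k (edge_to_angle r) p \<longleftrightarrow> iterates_to (Suc k) r p"
proof -
  have "(edge_to_angle ^^ (2 * n + k)) (edge_to_angle r) = (edge_to_angle ^^ (2 * n + Suc k)) r" for n
    by (metis add_Suc_right comp_apply funpow_Suc_right)
  then show ?thesis by (simp only: iterates_to_def)
qed

lemma iterates_to_add_2: "iterates_to (Suc (Suc k)) r p \<longleftrightarrow> iterates_to k r p"
  unfolding iterates_to_def
  using filterlim_sequentially_Suc[of "\<lambda>n. setdist ((edge_to_angle ^^ (2 * n + k)) r) p" "nhds 0"]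
  by simp

lemma opposite_equal_rot_ex:
  assumes "\<exists>i. edges Q $ i = edges Q $ (i + 2) \<or> angles Q $ i = angles Q $ (i + 2)"
  shows "\<exists>i. edges (rot k Q) $ i = edges (rot k Q) $ (i + 2) \<or> angles (rot k Q) $ i = angles (rot k Q) $ (i + 2)"
proof -
  from assms obtain i where i: "edges Q $ i = edges Q $ (i + 2) \<or> angles Q $ i = angles Q $ (i + 2)" ..
  have c: "i - k + 2 + k = i + 2" by simp
  show ?thesis
    unfolding edges_rot angles_rot rot_nth
    using i by (intro exI[of _ "i - k"]) (simp only: c diff_add_cancel)
qed

text \<open>
  Every labelling of a figure has the same opposite pairs, so one can choose the labelling that is
  close to \<open>R\<close>.
\<close>

lemma opposite_equal_near:
  assumes "r \<in> opposite_equal" "setdist r (figure_of R) < e"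
  obtains Q where "balanced Q" "r = figure_of Q"
    "\<And>i. \<bar>edges Q $ i - edges R $ i\<bar> < e" "\<And>i. \<bar>angles Q $ i - angles R $ i\<bar> < e"
    "\<exists>i. edges Q $ i = edges Q $ (i + 2) \<or> angles Q $ i = angles Q $ (i + 2)"
proof -
  obtain Q where Q: "balanced Q" "r = figure_of Q"
     "\<exists>i. edges Q $ i = edges Q $ (i + 2) \<or> angles Q $ i = angles Q $ (i + 2)"
    using assms(1) unfolding opposite_equal_def by blast
  obtain k where k: "dist (edges (rot k Q), angles (rot k Q)) (edges R, angles R) < e"
    using setdist_figure_less assms(2) Q(2) by metis
  show ?thesis
    using Q(2) dist_nth_less[OF k] opposite_equal_rot_ex[OF Q(3)]
    by (intro that[of "rot k Q"] balanced_rot Q(1)) (simp_all add: figure_of_rot)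
qed

lemma ex_opposite:
  "(\<exists>i. x $ i = x $ (i + 2) \<or> y $ i = y $ (i + 2)) \<longleftrightarrow>
    x $ 1 = x $ 3 \<or> x $ 2 = x $ 4 \<or> y $ 1 = y $ 3 \<or> y $ 2 = (y :: real^4) $ 4" for x :: "real^4"
  using forall_4[of "\<lambda>i. \<not> (x $ i = x $ (i + 2) \<or> y $ i = y $ (i + 2))"] by auto

lemma near_distinct:
  fixes x y :: real
  assumes "\<bar>x - a\<bar> < d" "\<bar>y - b\<bar> < d" "2 * d \<le> a - b \<or> 2 * d \<le> b - a"
  shows "x \<noteq> y"
  using assms by argo

text \<open>
  The numerical lower bounds keep the cycle away from the square. Then a figure close to one of its
  members has no other pair of equal opposite edges or angles than this member itself.
\<close>

locale trap_fixed_point =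
  fixes p assumes p: "1/20 \<le> p" "p < pi / 2" "trap_map p = p" "1/10 \<le> kite_param p"
begin

abbreviation v where "v \<equiv> kite_param p"
abbreviation T where "T \<equiv> trap_figure p"
abbreviation K where "K \<equiv> kite_figure (pi / 2 - v) (pi / 2)"

lemma v_bounds: "0 < v" "v < pi / 4" "v < pi / 2"
  using kite_param_bounds(1)[of p] kite_param_less[of p] p pi_gt_zero by linarith+

lemma p_range: "0 < p" "p \<le> pi / 2" using p by auto

lemma balanced_T: obtains R where "balanced R" "angles R = trap_angles p" "edges R = rot 1 (special_kite_angles v)" "figure_of R = T"
proof -
  obtain R where R: "balanced R" "angles R = trap_angles p"
    using balanced_exists trap_admissible[of p] p by auto
  with trap_edges[OF this] p that show ?thesis by auto
qed

lemma kite_to_trap_p: "kite_to_trap (pi / 2 - v) (pi / 2) = p"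
  using kite_to_trap_special[of v] v_bounds p(3) by (simp add: trap_map_def)

lemma balanced_K: obtains R where "balanced R" "angles R = special_kite_angles v" "edges R = rot 2 (trap_angles p)" "figure_of R = K"
proof -
  have adm: "admissible (special_kite_angles v)" using v_bounds by (intro kite_admissible) auto
  obtain R where R: "balanced R" "angles R = special_kite_angles v"
    using balanced_exists[OF adm] .
  with kite_edges[OF R] v_bounds that show ?thesis by (simp add: kite_to_trap_p)
qed

lemma T_to_K: "edge_to_angle T = K"
  using trap_step p by auto

lemma K_to_T: "edge_to_angle K = T"
  using kite_step[of v] v_bounds p(3) by (simp add: trap_map_def)

lemma setdist_tends:
  assumes "(x \<longlongrightarrow> p) F" "\<forall>\<^sub>F n in F. 0 < x n \<and> x n < pi / 2"
  shows "((\<lambda>n. setdist (trap_figure (x n)) T) \<longlongrightarrow> 0) F"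
    "((\<lambda>n. setdist (kite_figure (pi / 2 - kite_param (x n)) (pi / 2)) K) \<longlongrightarrow> 0) F"
proof -
  have k: "((\<lambda>n. kite_param (x n)) \<longlongrightarrow> v) F"
    using p pi_gt_zero by (intro isCont_tendsto_compose[OF continuous_kite_param assms(1)]) linarith+
  have t: "((\<lambda>n. trap_map (x n)) \<longlongrightarrow> trap_map p) F"
    by (intro isCont_tendsto_compose[OF continuous_trap_map assms(1)] p_range)
  have "((\<lambda>n. 4 * \<bar>kite_param (x n) - v\<bar> + 4 * \<bar>x n - p\<bar>) \<longlongrightarrow> 4 * \<bar>v - v\<bar> + 4 * \<bar>p - p\<bar>) F"
    by (intro tendsto_intros k assms)
  then have "((\<lambda>n. 4 * \<bar>kite_param (x n) - v\<bar> + 4 * \<bar>x n - p\<bar>) \<longlongrightarrow> 0) F" by simp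
  then show "((\<lambda>n. setdist (trap_figure (x n)) T) \<longlongrightarrow> 0) F"
    by (rule tendsto_sandwich[OF _ _ tendsto_const, rotated 2]) (auto intro: always_eventually setdist_trap)
  have "((\<lambda>n. 4 * \<bar>trap_map (x n) - trap_map p\<bar> + 4 * \<bar>kite_param (x n) - v\<bar>) \<longlongrightarrow> 4 * \<bar>trap_map p - trap_map p\<bar> + 4 * \<bar>v - v\<bar>) F"
    by (intro tendsto_intros k t)
  then have lim: "((\<lambda>n. 4 * \<bar>trap_map (x n) - trap_map p\<bar> + 4 * \<bar>kite_param (x n) - v\<bar>) \<longlongrightarrow> 0) F" by simp
  have special: "kite_to_trap (pi / 2 - kite_param u) (pi / 2) = trap_map u" if "0 < u" "u < pi / 2" for u
    using kite_to_trap_special[of "kite_param u"] kite_param_bounds(1)[of u] kite_param_less[OF that] that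
    by (simp add: trap_map_def)
  have le: "\<forall>\<^sub>F n in F. setdist (kite_figure (pi / 2 - kite_param (x n)) (pi / 2)) K \<le>
      4 * \<bar>trap_map (x n) - trap_map p\<bar> + 4 * \<bar>kite_param (x n) - v\<bar>"
    using assms(2)
  proof eventually_elim
    case (elim n)
    then show ?case
      using setdist_kite[of "pi / 2 - kite_param (x n)" "pi / 2" "pi / 2 - v" "pi / 2"] special[of "x n"] special[of p] p
      by (simp add: abs_minus_commute)
  qed
  show "((\<lambda>n. setdist (kite_figure (pi / 2 - kite_param (x n)) (pi / 2)) K) \<longlongrightarrow> 0) F"
    by (rule tendsto_sandwich[OF _ le tendsto_const lim]) simp
qed

lemma trap_iterates_to:
  assumes "0 < u" "u < pi / 2"
  shows "iterates_to 0 (trap_figure u) T" "iterates_to 1 (trap_figure u) K"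
proof -
  have r: "0 < (trap_map ^^ n) u \<and> (trap_map ^^ n) u < pi / 2" for n
    by (induction n) (use assms trap_map_bounds in \<open>auto simp: less_imp_le\<close>)
  have lim: "(\<lambda>n. (trap_map ^^ n) u) \<longlonglongrightarrow> p"
    using trap_map_iterates(4)[OF p_range p(3)] assms by simp
  have orbit: "(edge_to_angle ^^ (2 * n + 0)) (trap_figure u) = trap_figure ((trap_map ^^ n) u)" for n
    using trap_orbit(1)[OF assms] by simp
  show "iterates_to 0 (trap_figure u) T" "iterates_to 1 (trap_figure u) K"
    unfolding iterates_to_def orbit trap_orbit(2)[OF assms]
    using r by (intro setdist_tends[OF lim] always_eventually allI; simp)+
qed

lemma trap_stable:
  assumes "0 < e"
  obtains d where "0 < d" "\<And>u n. 0 < u \<Longrightarrow> u < pi / 2 \<Longrightarrow> \<bar>u - p\<bar> < d \<Longrightarrow>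
     min (setdist ((edge_to_angle ^^ n) (trap_figure u)) T) (setdist ((edge_to_angle ^^ n) (trap_figure u)) K) < e"
proof -
  have "\<forall>\<^sub>F u in nhds p. u \<in> {0<..<pi / 2}"
    using p_range p by (intro eventually_nhds_in_open) auto
  then have ev: "\<forall>\<^sub>F u in nhds p. 0 < u \<and> u < pi / 2" by simp
  have "\<forall>\<^sub>F u in nhds p. setdist (trap_figure u) T < e"
    using order_tendstoD(2)[OF setdist_tends(1)[OF filterlim_ident ev] assms] .
  moreover have "\<forall>\<^sub>F u in nhds p. setdist (kite_figure (pi / 2 - kite_param u) (pi / 2)) K < e"
    using order_tendstoD(2)[OF setdist_tends(2)[OF filterlim_ident ev] assms] .
  ultimately have "\<forall>\<^sub>F u in nhds p. setdist (trap_figure u) T < e \<and>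
      setdist (kite_figure (pi / 2 - kite_param u) (pi / 2)) K < e"
    by (rule eventually_conj)
  then obtain d where d: "0 < d" "\<And>u. dist u p < d \<Longrightarrow> setdist (trap_figure u) T < e \<and>
      setdist (kite_figure (pi / 2 - kite_param u) (pi / 2)) K < e"
    unfolding eventually_nhds_metric by blast
  show ?thesis
  proof (rule that[OF d(1)])
    fix u :: real and n :: nat assume u: "0 < u" "u < pi / 2" "\<bar>u - p\<bar> < d"
    have x: "dist ((trap_map ^^ m) u) p < d" for m
      using trap_map_iterates(3)[OF p_range p(3), of u m] u by (simp add: dist_real_def)
    define m where "m = n div 2"
    have m: "n = 2 * m \<or> n = 2 * m + 1" unfolding m_def by presburger
    have "setdist ((edge_to_angle ^^ (2 * m)) (trap_figure u)) T < e"
      "setdist ((edge_to_angle ^^ (2 * m + 1)) (trap_figure u)) K < e"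
      unfolding trap_orbit[OF u(1,2)] using d(2)[OF x] by auto
    with m show "min (setdist ((edge_to_angle ^^ n) (trap_figure u)) T) (setdist ((edge_to_angle ^^ n) (trap_figure u)) K) < e"
      by (metis min_less_iff_disj)
  qed
qed

lemma near_kite:
  assumes "0 < e"
  obtains d where "0 < d" "\<And>Q \<alpha> \<gamma>. balanced Q \<Longrightarrow> angles Q = kite_angles \<alpha> \<gamma> \<Longrightarrow>
     \<bar>\<alpha> - (pi / 2 - v)\<bar> < d \<Longrightarrow> \<bar>\<gamma> - pi / 2\<bar> < d \<Longrightarrow>
     setdist (figure_of Q) K < e \<and> (\<exists>u. 0 < u \<and> u < pi / 2 \<and> \<bar>u - p\<bar> < e \<and> edge_to_angle (figure_of Q) = trap_figure u)"
proof -
  let ?z = "(pi / 2 - v, pi / 2)"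
  let ?k = "\<lambda>z. kite_to_trap (fst z) (snd z)"
  have "0 < tri_perimeter (pi / 2 - v) (pi / 2)" using v_bounds by (intro tri_perimeter_pos) auto
  then have cont: "isCont ?k ?z"
    unfolding kite_to_trap_def tri_perimeter_def by (intro continuous_intros) auto
  have "((\<lambda>z. 4 * \<bar>?k z - ?k ?z\<bar> + 4 * \<bar>fst z - (pi / 2 - v)\<bar> + 2 * \<bar>snd z - pi / 2\<bar>) \<longlongrightarrow>
     4 * \<bar>?k ?z - ?k ?z\<bar> + 4 * \<bar>fst ?z - (pi / 2 - v)\<bar> + 2 * \<bar>snd ?z - pi / 2\<bar>) (nhds ?z)"
    by (intro tendsto_intros filterlim_ident isCont_tendsto_compose[OF cont])
  then have "((\<lambda>z. 4 * \<bar>?k z - ?k ?z\<bar> + 4 * \<bar>fst z - (pi / 2 - v)\<bar> + 2 * \<bar>snd z - pi / 2\<bar>) \<longlongrightarrow> 0) (nhds ?z)"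
    by simp
  from order_tendstoD(2)[OF this assms] obtain d where d: "0 < d"
    "\<And>z. dist z ?z < d \<Longrightarrow> 4 * \<bar>?k z - ?k ?z\<bar> + 4 * \<bar>fst z - (pi / 2 - v)\<bar> + 2 * \<bar>snd z - pi / 2\<bar> < e"
    unfolding eventually_nhds_metric by blast
  show ?thesis
  proof (rule that[of "min (d / 2) (v / 2)"])
    show "0 < min (d / 2) (v / 2)" using d v_bounds by simp
    fix Q \<alpha> \<gamma> assume Q: "balanced Q" "angles Q = kite_angles \<alpha> \<gamma>"
      and near: "\<bar>\<alpha> - (pi / 2 - v)\<bar> < min (d / 2) (v / 2)" "\<bar>\<gamma> - pi / 2\<bar> < min (d / 2) (v / 2)"
    have lt: "\<alpha> + \<gamma> < pi" using near by linarith
    have "dist (\<alpha>, \<gamma>) ?z \<le> \<bar>\<alpha> - (pi / 2 - v)\<bar> + \<bar>\<gamma> - pi / 2\<bar>"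
      by (simp add: dist_prod_def dist_real_def) (metis abs_ge_zero power2_abs sqrt_sum_squares_le_sum)
    then have "dist (\<alpha>, \<gamma>) ?z < d" using near by linarith
    from d(2)[OF this] have b: "4 * \<bar>kite_to_trap \<alpha> \<gamma> - p\<bar> + 4 * \<bar>\<alpha> - (pi / 2 - v)\<bar> + 2 * \<bar>\<gamma> - pi / 2\<bar> < e"
      by (simp add: kite_to_trap_p)
    have "figure_of Q = kite_figure \<alpha> \<gamma>" using kite_edges(2)[OF Q] lt by simp
    then have "setdist (figure_of Q) K < e"
      using setdist_kite[of \<alpha> \<gamma> "pi / 2 - v" "pi / 2"] b by (simp only: kite_to_trap_p)
    moreover have "\<bar>kite_to_trap \<alpha> \<gamma> - p\<bar> < e" using b by argo
    ultimately show "setdist (figure_of Q) K < e \<and> (\<exists>u. 0 < u \<and> u < pi / 2 \<and> \<bar>u - p\<bar> < e \<and> edge_to_angle (figure_of Q) = trap_figure u)"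
      using kite_step_of[OF Q lt] by blast
  qed
qed

text \<open>
  The edges and one pair of opposite angles of \<open>K\<close> are too far apart to become equal by a small
  change, so only the other pair of angles can be equal.
\<close>

lemma near_K_is_kite:
  assumes "r \<in> opposite_equal" "setdist r K < d" "d \<le> 1/20"
  obtains Q \<alpha> \<gamma> where "balanced Q" "r = figure_of Q" "angles Q = kite_angles \<alpha> \<gamma>"
    "\<bar>\<alpha> - (pi / 2 - v)\<bar> < d" "\<bar>\<gamma> - pi / 2\<bar> < d"
proof -
  obtain R where R: "balanced R" "angles R = special_kite_angles v" "edges R = rot 2 (trap_angles p)" "figure_of R = K"
    by (rule balanced_K)
  obtain Q where Q: "balanced Q" "r = figure_of Q" "\<And>i. \<bar>edges Q $ i - edges R $ i\<bar> < d"
     "\<And>i. \<bar>angles Q $ i - angles R $ i\<bar> < d"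
     "\<exists>i. edges Q $ i = edges Q $ (i + 2) \<or> angles Q $ i = angles Q $ (i + 2)"
    using opposite_equal_near[OF assms(1), of R d] assms(2) R(4) by auto
  note E = Q(3)[unfolded R] and A = Q(4)[unfolded R]
  have "edges Q $ 1 \<noteq> edges Q $ 3"
    by (rule near_distinct[OF E E]) (use p(1) assms(3) in \<open>simp add: trap_angles_def\<close>)
  moreover have "edges Q $ 2 \<noteq> edges Q $ 4"
    by (rule near_distinct[OF E E]) (use p(1) assms(3) in \<open>simp add: trap_angles_def\<close>)
  moreover have "angles Q $ 1 \<noteq> angles Q $ 3"
    by (rule near_distinct[OF A A]) (use p(4) assms(3) in \<open>simp add: kite_angles_def\<close>)
  ultimately have eq: "angles Q $ 2 = angles Q $ 4"
    using Q(5) by (simp add: ex_opposite)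
  have "admissible (angles Q)" using Q(1) balanced_convex convex_quadrangleD(1) by blast
  then have "angles Q = kite_angles (angles Q $ 2) (angles Q $ 3)"
    using eq admissibleD(3)[of "angles Q"] by (simp add: vec_eq_iff forall_4 kite_angles_def)
  then show ?thesis using that[OF Q(1,2)] A[of 2] A[of 3] by (simp add: kite_angles_def)
qed

text \<open>
  In the same way only the legs of \<open>T\<close> can stay equal, so that the next figure is a kite.
\<close>

lemma near_T_to_kite:
  assumes "r \<in> opposite_equal" "setdist r T < d" "d \<le> 1/20"
  obtains Q \<alpha> \<gamma> where "balanced Q" "edge_to_angle r = figure_of Q" "angles Q = kite_angles \<alpha> \<gamma>"
    "\<bar>\<alpha> - (pi / 2 - v)\<bar> < d" "\<bar>\<gamma> - pi / 2\<bar> < d"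
proof -
  obtain R where R: "balanced R" "angles R = trap_angles p" "edges R = rot 1 (special_kite_angles v)" "figure_of R = T"
    by (rule balanced_T)
  obtain Q where Q: "balanced Q" "r = figure_of Q" "\<And>i. \<bar>edges Q $ i - edges R $ i\<bar> < d"
     "\<And>i. \<bar>angles Q $ i - angles R $ i\<bar> < d"
     "\<exists>i. edges Q $ i = edges Q $ (i + 2) \<or> angles Q $ i = angles Q $ (i + 2)"
    using opposite_equal_near[OF assms(1), of R d] assms(2) R(4) by auto
  note E = Q(3)[unfolded R] and A = Q(4)[unfolded R]
  have "angles Q $ 1 \<noteq> angles Q $ 3"
    by (rule near_distinct[OF A A]) (use p(1) assms(3) in \<open>simp add: trap_angles_def\<close>)
  moreover have "angles Q $ 2 \<noteq> angles Q $ 4"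
    by (rule near_distinct[OF A A]) (use p(1) assms(3) in \<open>simp add: trap_angles_def\<close>)
  moreover have "edges Q $ 2 \<noteq> edges Q $ 4"
    by (rule near_distinct[OF E E]) (use p(4) assms(3) in \<open>simp add: kite_angles_def\<close>)
  ultimately have eq: "edges Q $ 1 = edges Q $ 3"
    using Q(5) by (simp add: ex_opposite)
  have "edges Q $ 1 + edges Q $ 2 + edges Q $ 3 + edges Q $ 4 = 2 * pi"
    using Q(1) by (simp add: balanced_def quadrangle_2pi_def sum_4)
  then have "edges Q = rot 1 (kite_angles (edges Q $ 1) (edges Q $ 2))"
    using eq by (simp add: vec_eq_iff forall_4 kite_angles_def)
  from edge_to_angle_rot[OF Q(1) this] obtain Q' where
    "balanced Q'" "angles Q' = kite_angles (edges Q $ 1) (edges Q $ 2)" "edge_to_angle (figure_of Q) = figure_of Q'" .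
  then show ?thesis using that[of Q'] E[of 1] E[of 2] Q(2) by (simp add: kite_angles_def)
qed

lemma iterates_to_if_next_trap:
  assumes "edge_to_angle r = trap_figure u" "0 < u" "u < pi / 2"
  shows "iterates_to 0 r K" "iterates_to 1 r T"
  using trap_iterates_to[OF assms(2,3)] unfolding assms(1)[symmetric] iterates_to_edge_to_angle
  by (simp_all add: iterates_to_add_2)

text \<open>
  The kite has a right angle and the trapezoid has none.
\<close>

lemma T_neq_K: "T \<noteq> K"
proof
  assume "T = K"
  obtain R where R: "angles R = trap_angles p" "figure_of R = T" by (rule balanced_T)
  obtain S where S: "angles S = special_kite_angles v" "figure_of S = K" by (rule balanced_K)
  have "figure_of R = figure_of S" using R S \<open>T = K\<close> by simp
  then obtain k where "angles S = rot k (angles R)" by (rule figure_of_eqD)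
  then have "trap_angles p $ (3 + k) = pi / 2" unfolding R S by (simp add: vec_eq_iff forall_4 kite_angles_def)
  moreover have "\<forall>i. trap_angles p $ i \<noteq> pi / 2" using p_range by (simp add: forall_4 trap_angles_def)
  ultimately show False by blast
qed

text \<open>
  One or two steps lead from a nearby figure to an isosceles trapezoid close to \<open>T\<close>, and from
  there on the interval map takes over.
\<close>

lemma attracting: "attracting_two_cycle_on opposite_equal T K"
proof -
  obtain R where R: "balanced R" "angles R = trap_angles p" "edges R = rot 1 (special_kite_angles v)" "figure_of R = T"
    by (rule balanced_T)
  obtain S where S: "balanced S" "angles S = special_kite_angles v" "edges S = rot 2 (trap_angles p)" "figure_of S = K"
    by (rule balanced_K)
  have cycle: "two_cycle T K"
    unfolding two_cycle_def balanced_figures_def using R S T_to_K K_to_T T_neq_K by auto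
  have "edges R $ 1 = edges R $ (1 + 2)" by (simp add: R kite_angles_def)
  then have TS: "T \<in> opposite_equal" using R(1,4) unfolding opposite_equal_def by blast
  have "angles S $ 2 = angles S $ (2 + 2)" by (simp add: S kite_angles_def)
  then have KS: "K \<in> opposite_equal" using S(1,4) unfolding opposite_equal_def by blast
  let ?f = edge_to_angle
  let ?m = "\<lambda>r. min (setdist r T) (setdist r K)"
  have stable: "\<exists>d>0. \<forall>r\<in>opposite_equal. ?m r < d \<longrightarrow> (\<forall>n. ?m ((?f ^^ n) r) < e)" if e: "0 < e" for e
  proof -
    obtain d1 where d1: "0 < d1" "\<And>u n. 0 < u \<Longrightarrow> u < pi / 2 \<Longrightarrow> \<bar>u - p\<bar> < d1 \<Longrightarrow> ?m ((?f ^^ n) (trap_figure u)) < e"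
      using trap_stable[OF e] by blast
    have "0 < min e d1" using e d1 by simp
    then obtain d2 where d2: "0 < d2" "\<And>Q \<alpha> \<gamma>. balanced Q \<Longrightarrow> angles Q = kite_angles \<alpha> \<gamma> \<Longrightarrow>
       \<bar>\<alpha> - (pi / 2 - v)\<bar> < d2 \<Longrightarrow> \<bar>\<gamma> - pi / 2\<bar> < d2 \<Longrightarrow>
       setdist (figure_of Q) K < min e d1 \<and> (\<exists>u. 0 < u \<and> u < pi / 2 \<and> \<bar>u - p\<bar> < min e d1 \<and> ?f (figure_of Q) = trap_figure u)"
      by (rule near_kite) blast
    have kite: "?m ((?f ^^ n) (figure_of Q)) < e"
      if Q: "balanced Q" "angles Q = kite_angles \<alpha> \<gamma>" "\<bar>\<alpha> - (pi / 2 - v)\<bar> < d2" "\<bar>\<gamma> - pi / 2\<bar> < d2" for Q \<alpha> \<gamma> n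
    proof (cases n)
      case 0
      then show ?thesis using d2(2)[OF Q] by (simp add: min_less_iff_disj)
    next
      case (Suc m)
      obtain u where "0 < u" "u < pi / 2" "\<bar>u - p\<bar> < d1" "?f (figure_of Q) = trap_figure u"
        using d2(2)[OF Q] by auto
      then show ?thesis using d1(2)[of u m] Suc by (simp add: funpow_Suc_right del: funpow.simps)
    qed
    \<comment> \<open>\<open>d2\<close> covers the figures near \<open>K\<close> and the images of those near \<open>T\<close>; \<open>e\<close> covers the 0th iterate.\<close>
    define d where "d = min (min e d2) (1/20)"
    have d: "0 < d" "d \<le> e" "d \<le> d2" "d \<le> 1/20" using e d2(1) by (auto simp: d_def)
    have "?m ((?f ^^ n) r) < e" if r: "r \<in> opposite_equal" "?m r < d" for r n
    proof (cases "setdist r K < d")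
      case True
      obtain Q \<alpha> \<gamma> where "balanced Q" "r = figure_of Q" "angles Q = kite_angles \<alpha> \<gamma>"
          "\<bar>\<alpha> - (pi / 2 - v)\<bar> < d" "\<bar>\<gamma> - pi / 2\<bar> < d"
        using near_K_is_kite[OF r(1) True d(4)] .
      then show ?thesis using kite[of Q \<alpha> \<gamma> n] d by simp
    next
      case False
      then have "setdist r T < d" using r(2) by simp
      then obtain Q \<alpha> \<gamma> where Q: "balanced Q" "?f r = figure_of Q" "angles Q = kite_angles \<alpha> \<gamma>"
          "\<bar>\<alpha> - (pi / 2 - v)\<bar> < d" "\<bar>\<gamma> - pi / 2\<bar> < d"
        using near_T_to_kite[OF r(1) _ d(4)] by blast
      show ?thesis
      proof (cases n)
        case 0
        then show ?thesis using r(2) d(2) by simp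
      next
        case (Suc m)
        then show ?thesis using kite[of Q \<alpha> \<gamma> m] Q d by (simp add: funpow_Suc_right del: funpow.simps)
      qed
    qed
    then show ?thesis using d(1) by blast
  qed
  have conv: "\<exists>d>0. \<forall>r\<in>opposite_equal. ?m r < d \<longrightarrow> converges_to_two_cycle r T K"
  proof -
    obtain d2 where d2: "0 < d2" "\<And>Q \<alpha> \<gamma>. balanced Q \<Longrightarrow> angles Q = kite_angles \<alpha> \<gamma> \<Longrightarrow>
       \<bar>\<alpha> - (pi / 2 - v)\<bar> < d2 \<Longrightarrow> \<bar>\<gamma> - pi / 2\<bar> < d2 \<Longrightarrow>
       setdist (figure_of Q) K < 1 \<and> (\<exists>u. 0 < u \<and> u < pi / 2 \<and> \<bar>u - p\<bar> < 1 \<and> ?f (figure_of Q) = trap_figure u)"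
      by (rule near_kite[of 1]) (simp, blast)
    have kite: "iterates_to 0 (figure_of Q) K \<and> iterates_to 1 (figure_of Q) T"
      if Q: "balanced Q" "angles Q = kite_angles \<alpha> \<gamma>" "\<bar>\<alpha> - (pi / 2 - v)\<bar> < d2" "\<bar>\<gamma> - pi / 2\<bar> < d2" for Q \<alpha> \<gamma>
      using d2(2)[OF Q] iterates_to_if_next_trap by blast
    define d where "d = min d2 (1/20)"
    have d: "0 < d" "d \<le> d2" "d \<le> 1/20" using d2(1) by (auto simp: d_def)
    have "converges_to_two_cycle r T K" if r: "r \<in> opposite_equal" "?m r < d" for r
    proof (cases "setdist r K < d")
      case True
      obtain Q \<alpha> \<gamma> where "balanced Q" "r = figure_of Q" "angles Q = kite_angles \<alpha> \<gamma>"
          "\<bar>\<alpha> - (pi / 2 - v)\<bar> < d" "\<bar>\<gamma> - pi / 2\<bar> < d"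
        using near_K_is_kite[OF r(1) True d(3)] .
      then show ?thesis using kite[of Q \<alpha> \<gamma>] d by (simp add: converges_to_two_cycle_def)
    next
      case False
      then have "setdist r T < d" using r(2) by simp
      then obtain Q \<alpha> \<gamma> where Q: "balanced Q" "?f r = figure_of Q" "angles Q = kite_angles \<alpha> \<gamma>"
          "\<bar>\<alpha> - (pi / 2 - v)\<bar> < d" "\<bar>\<gamma> - pi / 2\<bar> < d"
        using near_T_to_kite[OF r(1) _ d(3)] by blast
      then have "iterates_to 0 (?f r) K \<and> iterates_to 1 (?f r) T" using kite[of Q \<alpha> \<gamma>] d by simp
      then show ?thesis by (simp add: converges_to_two_cycle_def iterates_to_edge_to_angle iterates_to_add_2)
    qed
    then show ?thesis using d(1) by blast
  qed
  show ?thesis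
    unfolding attracting_two_cycle_on_def using cycle TS KS stable conv by blast
qed

text \<open>
  The image is a kite with two different angles on its axis; its own image is an isosceles trapezoid
  that is no rectangle, and the interval map attracts every such trapezoid.
\<close>

lemma opposite_edges_converge:
  assumes Q: "balanced Q" "edges Q = vector [\<alpha>, \<beta>, \<alpha>, \<gamma>]" and "\<beta> \<noteq> \<gamma>"
  shows "converges_to_two_cycle (figure_of Q) T K"
proof -
  have sum: "2 * \<alpha> + \<beta> + \<gamma> = 2 * pi"
    using Q by (simp add: balanced_def quadrangle_2pi_def sum_4)
  have main: "converges_to_two_cycle (figure_of Q) T K" if lt: "\<alpha> + \<delta> < pi" and e: "edges Q = rot k (kite_angles \<alpha> \<delta>)" for \<delta> k
  proof -
    obtain Q' where Q': "balanced Q'" "angles Q' = kite_angles \<alpha> \<delta>" "edge_to_angle (figure_of Q) = figure_of Q'"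
      using edge_to_angle_rot[OF Q(1) e] .
    note s = kite_step_of[OF Q'(1,2) lt]
    have "iterates_to 0 (edge_to_angle (figure_of Q)) K" "iterates_to 1 (edge_to_angle (figure_of Q)) T"
      unfolding Q'(3) using iterates_to_if_next_trap[OF s] by auto
    then show ?thesis by (simp add: converges_to_two_cycle_def iterates_to_edge_to_angle iterates_to_add_2)
  qed
  consider "\<gamma> < \<beta>" | "\<beta> < \<gamma>" using assms by linarith
  then show ?thesis
  proof cases
    case 1
    show ?thesis using 1 sum by (intro main[of \<gamma> 3]) (auto simp: vec_eq_iff forall_4 kite_angles_def Q)
  next
    case 2
    show ?thesis using 2 sum by (intro main[of \<beta> 1]) (auto simp: vec_eq_iff forall_4 kite_angles_def Q)
  qed
qed

end

theorem mainTheorem1: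
  shows "repelling_fixed_point (figure_of square) \<and>
    (\<exists>T K :: quadrangle. \<exists>a b c t :: real.
      balanced T \<and> balanced K \<and>
      angles T = vector [a, a, b, b] \<and> angles K = vector [c, pi / 2, c, pi / 2 + t] \<and>
      1.48342 \<le> a \<and> a < 1.48343 \<and> 1.65817 \<le> b \<and> b < 1.65818 \<and>
      1.44472 \<le> c \<and> c < 1.44473 \<and> 0.25214 \<le> t \<and> t < 0.25215 \<and>
      attracting_two_cycle_on opposite_equal (figure_of T) (figure_of K) \<and>
      (\<forall>Q \<alpha> \<beta> \<gamma>. balanced Q \<and> edges Q = vector [\<alpha>, \<beta>, \<alpha>, \<gamma>] \<and> \<beta> \<noteq> \<gamma> \<longrightarrow>
         converges_to_two_cycle (figure_of Q) (figure_of T) (figure_of K)))"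
proof (intro conjI square_repelling)
  obtain p where fp: "0.0873738 \<le> p" "p \<le> 0.0873758" "trap_map p = p"
    "0.1260705 \<le> kite_param p" "kite_param p \<le> 0.1260734"
    by (rule trap_map_fixed_point)
  have pi: "3.141592653 \<le> pi" "pi \<le> 3.141592654" using pi_approx by simp_all
  interpret trap_fixed_point p
    using fp pi by unfold_locales auto
  obtain R where R: "balanced R" "angles R = trap_angles p" "figure_of R = T" by (rule balanced_T)
  obtain S where S: "balanced S" "angles S = special_kite_angles v" "figure_of S = K" by (rule balanced_K)
  let ?T = "rot 2 R" and ?K = "rot 1 S"
  have T: "balanced ?T" "figure_of ?T = T" and K: "balanced ?K" "figure_of ?K = K"
    using R S by (simp_all add: balanced_rot figure_of_rot)
  have aT: "angles ?T = vector [pi / 2 - p, pi / 2 - p, pi / 2 + p, pi / 2 + p]"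
    by (simp add: angles_rot R trap_angles_def vec_eq_iff forall_4)
  have aK: "angles ?K = vector [pi / 2 - v, pi / 2, pi / 2 - v, pi / 2 + 2 * v]"
    by (simp add: angles_rot S kite_angles_def vec_eq_iff forall_4)
  have num: "1.48342 \<le> pi / 2 - p" "pi / 2 - p < 1.48343" "1.65817 \<le> pi / 2 + p" "pi / 2 + p < 1.65818"
      "1.44472 \<le> pi / 2 - v" "pi / 2 - v < 1.44473" "0.25214 \<le> 2 * v" "2 * v < 0.25215"
    using fp pi by simp_all
  show "\<exists>T K :: quadrangle. \<exists>a b c t :: real.
      balanced T \<and> balanced K \<and>
      angles T = vector [a, a, b, b] \<and> angles K = vector [c, pi / 2, c, pi / 2 + t] \<and>
      1.48342 \<le> a \<and> a < 1.48343 \<and> 1.65817 \<le> b \<and> b < 1.65818 \<and>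
      1.44472 \<le> c \<and> c < 1.44473 \<and> 0.25214 \<le> t \<and> t < 0.25215 \<and>
      attracting_two_cycle_on opposite_equal (figure_of T) (figure_of K) \<and>
      (\<forall>Q \<alpha> \<beta> \<gamma>. balanced Q \<and> edges Q = vector [\<alpha>, \<beta>, \<alpha>, \<gamma>] \<and> \<beta> \<noteq> \<gamma> \<longrightarrow>
         converges_to_two_cycle (figure_of Q) (figure_of T) (figure_of K))"
    by (intro exI[of _ ?T] exI[of _ ?K] exI[of _ "pi / 2 - p"] exI[of _ "pi / 2 + p"] exI[of _ "pi / 2 - v"] exI[of _ "2 * v"]
        conjI allI impI T(1) K(1) aT aK num)
      (auto simp: T K intro: attracting opposite_edges_converge)
qed

end
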